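(* There exist absolute constants $c_1,c_2,c_3,c_4>0$ such that the following holds. For every $\rho\in(0,1]$ and every positive integer $k\le c_1\rho^2n^{1/3}$, there is a $(c_2k/n)^k$-biased distribution $D$ on $\{-1,1\}^n$ and a threshold $t=c_3\sqrt{nk}/\rho$ such that \[ \Pr[B\ge t]\;\ge\;\Pr\Big[\sum_{i=1}^n (D\cdot N_\rho)_i\ge t\Big]+2^{-c_4k/\rho^2}. \]
   Context: $U$ is uniform on $\{-1,1\}^n$ and $B:=\sum_{i=1}^n U_i$. A distribution $D$ on $\{-1,1\}^n$ is $\varepsilon$-biased if for every nonempty $S\subseteq[n]$, $|\mathbb{E}[\prod_{i\in S}D_i]|\le\varepsilon$. $N_\rho$ is the distribution on $\{-1,1\}^n$ in which each coordinate is independently set to a uniform random bit with probability $1-\rho$ and to $1$ otherwise. $D\cdot N_\rho$ denotes the coordinate-wise product of independent samples of $D$ and $N_\rho$. *)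

theory Defs
  imports "HOL-Probability.Probability"
begin

(* Points of the cube are functions on the index set {1..n}, equal to undefined elsewhere.
   Their values are taken in the reals so that sums and products need no coercions. *)
definition cube :: "nat \<Rightarrow> (nat \<Rightarrow> real) set" where
  "cube n = {1..n} \<rightarrow>\<^sub>E {-1, 1}"

definition uniform_cube :: "nat \<Rightarrow> (nat \<Rightarrow> real) pmf" where
  "uniform_cube n = pmf_of_set (cube n)"

definition distribution_on_cube :: "nat \<Rightarrow> (nat \<Rightarrow> real) pmf \<Rightarrow> bool" where
  "distribution_on_cube n D \<longleftrightarrow> set_pmf D \<subseteq> cube n"

definition biased :: "nat \<Rightarrow> real \<Rightarrow> (nat \<Rightarrow> real) pmf \<Rightarrow> bool" where
  "biased n \<epsilon> D \<longleftrightarrow>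
     (\<forall>S. S \<subseteq> {1..n} \<and> S \<noteq> {} \<longrightarrow>
        \<bar>measure_pmf.expectation D (\<lambda>x. \<Prod>i\<in>S. x i)\<bar> \<le> \<epsilon>)"

(* bernoulli_pmf clips its parameter to [0,1]; only 0 \<le> \<rho> \<le> 1 is meaningful here. *)
definition noise_bit :: "real \<Rightarrow> real pmf" where
  "noise_bit \<rho> =
     bind_pmf (bernoulli_pmf (1 - \<rho>))
       (\<lambda>rerandomize. if rerandomize then pmf_of_set {-1, 1} else return_pmf 1)"

definition noise :: "nat \<Rightarrow> real \<Rightarrow> (nat \<Rightarrow> real) pmf" where
  "noise n \<rho> = Pi_pmf {1..n} undefined (\<lambda>_. noise_bit \<rho>)"

definition coord_product ::
    "nat \<Rightarrow> (nat \<Rightarrow> real) pmf \<Rightarrow> (nat \<Rightarrow> real) pmf \<Rightarrow> (nat \<Rightarrow> real) pmf" where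
  "coord_product n D E = map_pmf (\<lambda>(x, z). \<lambda>i\<in>{1..n}. x i * z i) (pair_pmf D E)"

definition coord_sum :: "nat \<Rightarrow> (nat \<Rightarrow> real) \<Rightarrow> real" where
  "coord_sum n x = (\<Sum>i=1..n. x i)"

end

(*
  A distribution of bounded sum.  Write R = sqrt (n k) and let b be the sum of the coordinates.  The
  mass of the uniform distribution outside |b| <= 12 R is so small, compared with the growth of the
  degree-2k symmetric polynomials there, that the density 1 can be corrected on |b| <= 12 R by a
  symmetric polynomial p of degree < 2k with |p| <= 1, so that the density 1 + p on |b| <= 12 R
  (and 0 elsewhere) has vanishing Fourier coefficients at all levels 1, ..., 2k - 1.  By Bessel's
  inequality and symmetry its coefficients at level s are at most 2 / sqrt (n choose s), which is
  (O(k/n))^k for 2k <= s <= n/2.  One extra round of noise with parameter 1/2 makes the levels above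
  n/2 exponentially small; together with the noise of the theorem it acts like noise with parameter
  rho/2.

  The tail.  Given a point x, the probability that the noisy version of x has sum at least t depends
  only on b(x).  As a function of t it is log-concave, and a Chernoff bound then shows that it decays at
  rate at least t / (16 n).  Hence each coordinate of x flipped from -1 to 1 increases it by a factor
  1 + Omega(rho t / n), and moving from b = 12 R to b = 24 R by a factor exp (Omega(c3 k)).  For large
  c3 this beats the probability exp (-O(k)) of b >= 24 R under the uniform distribution, so the tail
  of B, which is the average over uniform x of the noisy tails, is at least twice the noisy tail at any
  point with b <= 12 R.
*)
theory Submission
  imports Defs "Jordan_Normal_Form.Determinant"
begin

section \<open>Tails of sums of biased signs\<close>

text \<open>For \<open>r\<close> in [0,1], the probability that \<open>a\<close> independent signs
  of mean \<open>r\<close> and \<open>c\<close> independent signs of mean \<open>- r\<close> sum to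
  at least \<open>s\<close>. The recursion over the signs allows proofs by plain induction, with no
  probability space.\<close>

fun tail :: "real \<Rightarrow> nat \<Rightarrow> nat \<Rightarrow> real \<Rightarrow> real" where
  "tail r 0 0 s = (if s \<le> 0 then 1 else 0)"
| "tail r (Suc a) c s = (1 + r) / 2 * tail r a c (s - 1) + (1 - r) / 2 * tail r a c (s + 1)"
| "tail r 0 (Suc c) s = (1 - r) / 2 * tail r 0 c (s - 1) + (1 + r) / 2 * tail r 0 c (s + 1)"

text \<open>The recursion peels off the signs of mean \<open>r\<close> first; the two averaging
  operators commute, so a sign of mean \<open>- r\<close> may be peeled off first as well.\<close>

lemma tail_Suc_right:
  "tail r a (Suc c) s = (1 - r) / 2 * tail r a c (s - 1) + (1 + r) / 2 * tail r a c (s + 1)"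
proof (induction a arbitrary: s)
  case (Suc a)
  show ?case unfolding tail.simps Suc.IH by (simp add: field_simps)
qed simp

text \<open>Both recursive equations are one two-point average, with \<open>w = r\<close> and
  \<open>w = - r\<close>, so a property stable under all such averages needs a single induction
  step.\<close>

lemma tail_closed:
  assumes r: "0 \<le> r" "r \<le> 1"
    and base: "P (\<lambda>s. if s \<le> 0 then 1 else 0)"
    and step: "\<And>f w. -1 \<le> w \<Longrightarrow> w \<le> 1 \<Longrightarrow> P f \<Longrightarrow>
      P (\<lambda>s. (1 + w) / 2 * f (s - 1) + (1 - w) / 2 * f (s + 1))"
  shows "P (tail r a c)"
proof (induction a)
  case 0
  show ?case
  proof (induction c)
    case 0
    have "tail r 0 0 = (\<lambda>s. if s \<le> 0 then 1 else 0)" by auto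
    with base show ?case by simp
  next
    case (Suc c)
    have "tail r 0 (Suc c) = (\<lambda>s. (1 + - r) / 2 * tail r 0 c (s - 1) + (1 - - r) / 2 * tail r 0 c (s + 1))"
      by auto
    with step[of "- r", OF _ _ Suc] r show ?case by simp
  qed
next
  case (Suc a)
  have "tail r (Suc a) c = (\<lambda>s. (1 + r) / 2 * tail r a c (s - 1) + (1 - r) / 2 * tail r a c (s + 1))"
    by auto
  with step[of r, OF _ _ Suc] r show ?case by simp
qed

lemma tail_antimono:
  assumes "0 \<le> r" "r \<le> 1" shows "antimono (tail r a c)"
  by (rule tail_closed[OF assms])
    (auto simp: antimono_def intro!: add_mono mult_left_mono)

lemma tail_nonneg:
  assumes "0 \<le> r" "r \<le> 1" shows "0 \<le> tail r a c s"
proof -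
  have "\<forall>s. 0 \<le> tail r a c s"
    by (rule tail_closed[OF assms]) (auto intro!: add_nonneg_nonneg mult_nonneg_nonneg)
  then show ?thesis by simp
qed

text \<open>Log-concavity along steps of length two is stated for pairs of arguments rather than for
  a single one, because only this form is inherited by two-point averages without a discussion
  of zeros.\<close>

lemma tail_log_concave:
  assumes "0 \<le> r" "r \<le> 1"
  shows "tail r a c (s - 2) * tail r a c (s + 2 * real j + 2)
    \<le> tail r a c s * tail r a c (s + 2 * real j)"
proof -
  let ?P = "\<lambda>f :: real \<Rightarrow> real. (\<forall>s. 0 \<le> f s) \<and>
    (\<forall>s. \<forall>j::nat. f (s - 2) * f (s + 2 * real j + 2) \<le> f s * f (s + 2 * real j))"
  have "?P (tail r a c)"
  proof (rule tail_closed[OF assms])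
    show "?P (\<lambda>s. if s \<le> 0 then 1 else 0)" by auto
  next
    fix f :: "real \<Rightarrow> real" and w :: real
    assume w: "-1 \<le> w" "w \<le> 1" and "?P f"
    then have f0: "0 \<le> f s" and lc: "f (s - 2) * f (s + 2 * real j + 2) \<le> f s * f (s + 2 * real j)"
      for s and j :: nat by blast+
    define p q where "p = (1 + w) / 2" and "q = (1 - w) / 2"
    have pq: "0 \<le> p" "0 \<le> q" using w by (simp_all add: p_def q_def)
    show "?P (\<lambda>s. (1 + w) / 2 * f (s - 1) + (1 - w) / 2 * f (s + 1))"
      unfolding p_def[symmetric] q_def[symmetric]
    proof (intro conjI allI)
      show "0 \<le> p * f (s - 1) + q * f (s + 1)" for s using pq f0 by simp
    next
      fix s and j :: nat
      define x where "x = s + 2 * real j"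
      have 1: "f (s - 3) * f (x + 1) \<le> f (s - 1) * f (x - 1)"
        using lc[of "s - 1" j] by (simp add: x_def algebra_simps)
      have 2: "f (s - 1) * f (x + 3) \<le> f (s + 1) * f (x + 1)"
        using lc[of "s + 1" j] by (simp add: x_def algebra_simps)
      have 3: "f (s - 3) * f (x + 3) \<le> f (s - 1) * f (x + 1)"
        using lc[of "s - 1" "Suc j"] by (simp add: x_def algebra_simps)
      \<comment> \<open>After expansion the term p q f(s-1) f(x+1) occurs on both sides and cancels;
        this is what remains of the p q terms. For j = 0 the right side of \<open>3\<close> is
        already the target, otherwise one more use of log-concavity leads to it.\<close>
      have 4: "f (s - 3) * f (x + 3) \<le> f (s + 1) * f (x - 1)"
      proof (cases j)
        case 0
        with 3 show ?thesis by (simp add: x_def mult.commute)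
      next
        case (Suc i)
        have "f (s - 1) * f (x + 1) \<le> f (s + 1) * f (x - 1)"
          using lc[of "s + 1" i] by (simp add: x_def Suc algebra_simps)
        with 3 show ?thesis by simp
      qed
      have "p * p * (f (s - 3) * f (x + 1)) + q * q * (f (s - 1) * f (x + 3))
          + p * q * (f (s - 3) * f (x + 3))
        \<le> p * p * (f (s - 1) * f (x - 1)) + q * q * (f (s + 1) * f (x + 1))
          + p * q * (f (s + 1) * f (x - 1))"
        using 1 2 4 pq by (intro add_mono mult_left_mono mult_nonneg_nonneg)
      then have "(p * f (s - 3) + q * f (s - 1)) * (p * f (x + 1) + q * f (x + 3))
          \<le> (p * f (s - 1) + q * f (s + 1)) * (p * f (x - 1) + q * f (x + 1))"
        by (simp add: algebra_simps)
      then show "(p * f (s - 2 - 1) + q * f (s - 2 + 1))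
            * (p * f (s + 2 * real j + 2 - 1) + q * f (s + 2 * real j + 2 + 1))
          \<le> (p * f (s - 1) + q * f (s + 1))
            * (p * f (s + 2 * real j - 1) + q * f (s + 2 * real j + 1))"
        by (simp add: x_def algebra_simps)
    qed
  qed
  then show ?thesis by blast
qed

section \<open>Exponential moment bounds for sums of biased signs\<close>

lemma sinh_le_mult_cosh:
  fixes x :: real assumes "0 \<le> x" shows "sinh x \<le> x * cosh x"
proof -
  have "(\<lambda>x. x * cosh x - sinh x) 0 \<le> (\<lambda>x. x * cosh x - sinh x) x"
  proof (rule DERIV_nonneg_imp_nondecreasing[OF assms])
    fix y :: real assume "0 \<le> y"
    then show "\<exists>z. ((\<lambda>x. x * cosh x - sinh x) has_real_derivative z) (at y) \<and> 0 \<le> z"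
      by (intro exI[of _ "y * sinh y"] conjI) (auto intro!: derivative_eq_intros)
  qed
  then show ?thesis by simp
qed

text \<open>The sub-Gaussian bound for a fair sign: x^2/2 - ln (cosh x) vanishes at 0 and has
  derivative x - tanh x, nonnegative for x >= 0; both sides are even.\<close>

lemma cosh_le_exp_square: "cosh x \<le> exp (x\<^sup>2 / 2)" for x :: real
proof -
  have *: "cosh y \<le> exp (y\<^sup>2 / 2)" if "0 \<le> y" for y :: real
  proof -
    have "(\<lambda>x. x\<^sup>2 / 2 - ln (cosh x)) 0 \<le> (\<lambda>x. x\<^sup>2 / 2 - ln (cosh x)) y"
    proof (rule DERIV_nonneg_imp_nondecreasing[OF that])
      fix z :: real assume z: "0 \<le> z"
      have "sinh z / cosh z \<le> z"
        using sinh_le_mult_cosh[OF z] by (simp add: field_simps)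
      then show "\<exists>d. ((\<lambda>x. x\<^sup>2 / 2 - ln (cosh x)) has_real_derivative d) (at z) \<and> 0 \<le> d"
        by (intro exI[of _ "z - sinh z / cosh z"] conjI)
          (auto intro!: derivative_eq_intros simp: field_simps)
    qed
    then have "ln (cosh y) \<le> y\<^sup>2 / 2" by simp
    then show ?thesis
      by (metis cosh_real_pos exp_le_cancel_iff exp_ln)
  qed
  show ?thesis
    using *[of x] *[of "- x"] by (cases "0 \<le> x") auto
qed

text \<open>Exponentials are eigenfunctions of the two-point average, with eigenvalue
  \<open>cosh l - w * sinh l\<close>; \<open>M\<close> collects the eigenvalues of the other
  signs.\<close>

lemma exp_average_step:
  fixes l w :: real
  shows "(1 + w) / 2 * (exp (l * (s - 1)) * M) + (1 - w) / 2 * (exp (l * (s + 1)) * M)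
    = exp (l * s) * ((cosh l - w * sinh l) * M)"
proof -
  have 1: "exp (l * (s - 1)) = exp (l * s) * (cosh l - sinh l)"
    by (simp add: cosh_minus_sinh algebra_simps flip: exp_add)
  have 2: "exp (l * (s + 1)) = exp (l * s) * (cosh l + sinh l)"
    by (simp add: cosh_plus_sinh algebra_simps flip: exp_add)
  show ?thesis unfolding 1 2 by (simp add: field_simps)
qed

text \<open>Exponential Markov inequality: exp (- l s) dominates the indicator of s <= 0, and each
  averaging step contributes its eigenvalue. The product of powers is the moment generating function
  of the sum at \<open>l\<close>.\<close>

lemma tail_le:
  assumes "0 \<le> r" "r \<le> 1" "0 \<le> l"
  shows "tail r a c s \<le> exp (- l * s) * ((cosh l + r * sinh l) ^ a * (cosh l - r * sinh l) ^ c)"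
  using assms
proof (induction r a c s rule: tail.induct)
  case (1 r s)
  then show ?case by (auto simp: mult_nonneg_nonpos)
next
  case (2 r a c s)
  let ?M = "(cosh l + r * sinh l) ^ a * (cosh l - r * sinh l) ^ c"
  have "tail r (Suc a) c s \<le> (1 + r) / 2 * (exp (- l * (s - 1)) * ?M)
      + (1 - r) / 2 * (exp (- l * (s + 1)) * ?M)"
    unfolding tail.simps using 2 by (intro add_mono mult_left_mono) auto
  also have "\<dots> = exp (- l * s) * ((cosh l + r * sinh l) * ?M)"
    unfolding exp_average_step by simp
  finally show ?case by (simp add: mult.assoc)
next
  case (3 r c s)
  let ?M = "(cosh l - r * sinh l) ^ c"
  have "tail r 0 (Suc c) s \<le> (1 - r) / 2 * (exp (- l * (s - 1)) * ?M)
      + (1 + r) / 2 * (exp (- l * (s + 1)) * ?M)"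
    unfolding tail.simps using 3 by (intro add_mono mult_left_mono) auto
  also have "\<dots> = (1 + - r) / 2 * (exp (- l * (s - 1)) * ?M)
      + (1 - - r) / 2 * (exp (- l * (s + 1)) * ?M)" by simp
  also have "\<dots> = exp (- l * s) * ((cosh l - r * sinh l) * ?M)"
    unfolding exp_average_step by simp
  finally show ?case by (simp add: mult.assoc)
qed

text \<open>The exponential Markov inequality for the complementary event: 1 - exp (l s) lies below
  the indicator of s <= 0.\<close>

lemma tail_ge:
  assumes "0 \<le> r" "r \<le> 1" "0 \<le> l"
  shows "1 - exp (l * s) * ((cosh l - r * sinh l) ^ a * (cosh l + r * sinh l) ^ c) \<le> tail r a c s"
  using assms
proof (induction r a c s rule: tail.induct)
  case (1 r s)
  then show ?case by auto
next
  case (2 r a c s)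
  let ?M = "(cosh l - r * sinh l) ^ a * (cosh l + r * sinh l) ^ c"
  have "1 - exp (l * s) * ((cosh l - r * sinh l) * ?M)
      = (1 + r) / 2 * (1 - exp (l * (s - 1)) * ?M) + (1 - r) / 2 * (1 - exp (l * (s + 1)) * ?M)"
    unfolding exp_average_step[symmetric] by (simp add: field_simps)
  also have "\<dots> \<le> tail r (Suc a) c s"
    unfolding tail.simps using 2 by (intro add_mono mult_left_mono) auto
  finally show ?case by (simp add: mult.assoc)
next
  case (3 r c s)
  let ?M = "(cosh l + r * sinh l) ^ c"
  have "1 - exp (l * s) * ((cosh l - - r * sinh l) * ?M)
      = (1 - r) / 2 * (1 - exp (l * (s - 1)) * ?M) + (1 + r) / 2 * (1 - exp (l * (s + 1)) * ?M)"
    unfolding exp_average_step[symmetric] by (simp add: field_simps)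
  also have "\<dots> \<le> tail r 0 (Suc c) s"
    unfolding tail.simps using 3 by (intro add_mono mult_left_mono) auto
  finally show ?case by (simp add: mult.assoc)
qed

lemma biased_mgf_le:
  fixes l r :: real
  assumes r: "\<bar>r\<bar> \<le> 1" and l: "0 \<le> l"
  shows "(cosh l + r * sinh l) ^ a * (cosh l - r * sinh l) ^ c
    \<le> exp (real (a + c) * l\<^sup>2 / 2) * exp (r * (sinh l / cosh l) * (real a - real c))"
proof -
  let ?\<tau> = "sinh l / cosh l"
  have pos: "0 \<le> cosh l + w * sinh l" and le: "cosh l + w * sinh l \<le> exp (l\<^sup>2 / 2) * exp (w * ?\<tau>)"
    if "\<bar>w\<bar> \<le> 1" for w :: real
  proof -
    have "\<bar>w * sinh l\<bar> \<le> 1 * cosh l"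
      unfolding abs_mult using that sinh_le_cosh_real[of l] l by (intro mult_mono) auto
    then show "0 \<le> cosh l + w * sinh l" by linarith
    have "cosh l + w * sinh l = cosh l * (1 + w * ?\<tau>)" by (simp add: field_simps)
    also have "\<dots> \<le> cosh l * exp (w * ?\<tau>)"
      by (intro mult_left_mono exp_ge_add_one_self) (simp add: less_imp_le)
    also have "\<dots> \<le> exp (l\<^sup>2 / 2) * exp (w * ?\<tau>)"
      by (intro mult_right_mono cosh_le_exp_square) simp
    finally show "cosh l + w * sinh l \<le> exp (l\<^sup>2 / 2) * exp (w * ?\<tau>)" .
  qed
  have "(cosh l + r * sinh l) ^ a * (cosh l + (- r) * sinh l) ^ c
    \<le> (exp (l\<^sup>2 / 2) * exp (r * ?\<tau>)) ^ a * (exp (l\<^sup>2 / 2) * exp (- r * ?\<tau>)) ^ c"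
    using r by (intro mult_mono power_mono le pos zero_le_power mult_nonneg_nonneg) auto
  also have "\<dots> = exp (real (a + c) * l\<^sup>2 / 2) * exp (r * ?\<tau> * (real a - real c))"
  proof -
    have *: "(exp A * exp B) ^ a * (exp A * exp (- B)) ^ c
        = exp (real (a + c) * A + B * (real a - real c))" for A B :: real
      by (simp add: algebra_simps flip: exp_add exp_of_nat_mult)
    show ?thesis using *[of "l\<^sup>2 / 2" "r * ?\<tau>"] by (simp add: exp_add)
  qed
  finally show ?thesis unfolding minus_mult_left[symmetric] add_uminus_conv_diff .
qed

text \<open>If the step from t - 1 to t + 1 lost less than the fraction t / (16 n), then by
  log-concavity so would every earlier step. Going back about t/2 + sqrt n steps reaches a point
  where the tail is at least 1/2, so the tail at t + 1 would exceed its Chernoff bound.\<close>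

lemma tail_hazard:
  assumes r: "0 \<le> r" "r \<le> 1" and ac: "c \<le> a" "a + c \<le> n"
    and mean: "r * (real a - real c) \<le> t / 4"
    and t: "8 * sqrt (real n) \<le> t" "t \<le> real n" and n: "0 < n"
  shows "tail r a c (t + 1) \<le> (1 - t / (16 * real n)) * tail r a c (t - 1)"
proof (rule ccontr)
  define \<delta> where "\<delta> = t / (16 * real n)"
  assume "\<not> ?thesis"
  then have contra: "(1 - \<delta>) * tail r a c (t - 1) < tail r a c (t + 1)" by (simp add: \<delta>_def)
  define u where "u i = tail r a c (t + 1 - 2 * real i)" for i
  have sqrtn: "1 \<le> sqrt (real n)" using n by simp
  then have t8: "8 \<le> t" using t by linarith
  have nn: "sqrt (real n) * sqrt (real n) = real n" by simp
  have \<delta>: "0 \<le> \<delta>" "\<delta> \<le> 1 / 16" using t8 t n by (simp_all add: \<delta>_def field_simps)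
  have u0: "0 \<le> u i" for i unfolding u_def by (rule tail_nonneg[OF r])
  have u_Suc: "u i \<le> u (Suc i)" for i
    unfolding u_def by (rule antimonoD[OF tail_antimono[OF r]]) simp
  have u1: "0 < u 1"
  proof (rule ccontr)
    assume "\<not> 0 < u 1"
    then have "u 1 = 0" "u 0 = 0" using u0[of 1] u_Suc[of 0] u0[of 0] by auto
    with contra show False by (simp add: u_def)
  qed
  \<comment> \<open>By log-concavity the ratio u i / u (Suc i) is at least its value at i = 0, which
    exceeds 1 - \<open>\<delta>\<close> by \<open>contra\<close>. The cross-multiplied form needs
    only \<open>u1\<close>.\<close>
  have step: "(1 - \<delta>) * u (Suc i) \<le> u i" for i
  proof (cases i)
    case 0
    then show ?thesis using contra by (simp add: u_def)
  next
    case (Suc j)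
    have "u 0 * u (Suc i) \<le> u 1 * u i"
      using tail_log_concave[OF r, of a c "t + 1 - 2 * real i" j]
      by (simp add: u_def Suc algebra_simps)
    moreover have "(1 - \<delta>) * u 1 * u (Suc i) \<le> u 0 * u (Suc i)"
      using contra by (intro mult_right_mono u0) (simp add: u_def)
    ultimately have "u 1 * ((1 - \<delta>) * u (Suc i)) \<le> u 1 * u i" by (simp add: algebra_simps)
    with u1 show ?thesis by simp
  qed
  have pow: "(1 - \<delta>) ^ i * u i \<le> u 0" for i
  proof (induction i)
    case (Suc i)
    have "(1 - \<delta>) ^ Suc i * u (Suc i) = (1 - \<delta>) ^ i * ((1 - \<delta>) * u (Suc i))" by simp
    also have "\<dots> \<le> (1 - \<delta>) ^ i * u i" using step \<delta> by (intro mult_left_mono) auto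
    finally show ?case using Suc by simp
  qed simp
  \<comment> \<open>Large enough for t + 1 - 2 N to lie below -2 sqrt n, yet at most t, so that the
    accumulated loss stays small.\<close>
  define N where "N = nat \<lceil>t / 2 + sqrt (real n) + 1\<rceil>"
  have N: "t / 2 + sqrt (real n) + 1 \<le> real N" "real N \<le> t"
    using t8 t sqrtn unfolding N_def by linarith+
  have tanh: "sinh l / cosh l \<le> l" "0 \<le> sinh l / cosh l" if "0 \<le> l" for l :: real
    using sinh_le_mult_cosh[OF that] that by (simp_all add: field_simps)
  have acr: "real a - real c \<ge> 0" "real (a + c) \<le> real n" using ac by simp_all
  have upper: "u 0 \<le> exp (- (9 / 32 * (t\<^sup>2 / real n)))"
  proof -
    \<comment> \<open>The minimiser of - l t + n l^2/2 + l t/4, where t/4 bounds the mean; the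
      minimum is -9 t^2 / (32 n).\<close>
    define l where "l = 3 / 4 * t / real n"
    have l: "0 \<le> l" using t8 by (simp add: l_def)
    have "u 0 \<le> exp (- l * (t + 1)) * (exp (real (a + c) * l\<^sup>2 / 2)
        * exp (r * (sinh l / cosh l) * (real a - real c)))"
    proof -
      have "u 0 \<le> exp (- l * (t + 1)) * ((cosh l + r * sinh l) ^ a * (cosh l - r * sinh l) ^ c)"
        using tail_le[OF r l, of a c "t + 1"] by (simp add: u_def)
      also have "\<dots> \<le> exp (- l * (t + 1)) * (exp (real (a + c) * l\<^sup>2 / 2)
          * exp (r * (sinh l / cosh l) * (real a - real c)))"
        using r l by (intro mult_left_mono biased_mgf_le) auto
      finally show ?thesis .
    qed
    also have "\<dots> \<le> exp (- l * t) * (exp (real n * l\<^sup>2 / 2) * exp (l * (t / 4)))"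
    proof -
      have "r * (sinh l / cosh l) * (real a - real c) = (sinh l / cosh l) * (r * (real a - real c))"
        by simp
      also have "\<dots> \<le> l * (t / 4)"
        using tanh[OF l] mean t8 l r acr by (intro mult_mono) auto
      finally have 1: "r * (sinh l / cosh l) * (real a - real c) \<le> l * (t / 4)" .
      have 2: "real (a + c) * l\<^sup>2 \<le> real n * l\<^sup>2"
        using acr by (intro mult_right_mono) auto
      have 3: "- l * (t + 1) \<le> - l * t" using l by (simp add: algebra_simps)
      show ?thesis using 1 2 3 by (intro mult_mono) (simp_all only: exp_le_cancel_iff, simp_all)
    qed
    also have "\<dots> = exp (- l * t + (real n * l\<^sup>2 / 2 + l * (t / 4)))"
      by (simp only: exp_add)
    also have "- l * t + (real n * l\<^sup>2 / 2 + l * (t / 4)) = - (9 / 32 * (t\<^sup>2 / real n))"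
      using n by (simp add: l_def field_simps power2_eq_square)
    finally show ?thesis .
  qed
  have lower: "1 / 2 \<le> u N"
  proof -
    \<comment> \<open>The minimiser of -2 l sqrt n + n l^2/2, with minimum -2. The mean is
      nonnegative and only helps.\<close>
    define l where "l = 2 / sqrt (real n)"
    have l: "0 \<le> l" by (simp add: l_def)
    have nl: "real n * l\<^sup>2 = 4" "l * sqrt (real n) = 2"
      using n by (simp_all add: l_def power_divide)
    have s: "t + 1 - 2 * real N \<le> - 2 * sqrt (real n)" using N by simp
    have "exp (l * (t + 1 - 2 * real N)) * ((cosh l - r * sinh l) ^ a * (cosh l + r * sinh l) ^ c)
      \<le> exp (- 4) * (exp 2 * 1)"
    proof (rule mult_mono)
      have "l * (t + 1 - 2 * real N) \<le> l * (- 2 * sqrt (real n))"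
        using s l by (rule mult_left_mono)
      also have "\<dots> = - 4" using nl by simp
      finally show "exp (l * (t + 1 - 2 * real N)) \<le> exp (- 4)" by simp
      have "(cosh l - r * sinh l) ^ a * (cosh l + r * sinh l) ^ c
        \<le> exp (real (a + c) * l\<^sup>2 / 2) * exp (- r * (sinh l / cosh l) * (real a - real c))"
        using biased_mgf_le[of "- r" l a c] r l by simp
      also have "\<dots> \<le> exp 2 * 1"
      proof (intro mult_mono)
        have "real (a + c) * l\<^sup>2 \<le> real n * l\<^sup>2" using acr by (intro mult_right_mono) auto
        then show "exp (real (a + c) * l\<^sup>2 / 2) \<le> exp 2" using nl by simp
        have "0 \<le> r * (sinh l / cosh l) * (real a - real c)"
          using r tanh[OF l] acr by (intro mult_nonneg_nonneg) auto
        then show "exp (- r * (sinh l / cosh l) * (real a - real c)) \<le> 1" by simp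
      qed auto
      finally show "(cosh l - r * sinh l) ^ a * (cosh l + r * sinh l) ^ c \<le> exp 2 * 1" .
      have "\<bar>r * sinh l\<bar> \<le> 1 * cosh l"
        unfolding abs_mult using r sinh_le_cosh_real[of l] l by (intro mult_mono) auto
      then show "0 \<le> (cosh l - r * sinh l) ^ a * (cosh l + r * sinh l) ^ c"
        by (intro mult_nonneg_nonneg zero_le_power) auto
    qed auto
    also have "\<dots> = exp (- 2 :: real)" by (simp flip: exp_add)
    also have "\<dots> \<le> 1 / 2"
      using exp_ge_add_one_self[of "2::real"] by (simp add: exp_minus field_simps)
    finally show ?thesis
      using tail_ge[OF r l, of "t + 1 - 2 * real N" a c] by (simp add: u_def)
  qed
  \<comment> \<open>As 1 - \<open>\<delta>\<close> is at least exp (-2 \<open>\<delta>\<close>) and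
    N <= t, the N steps cost at most 2 \<open>\<delta>\<close> t = t^2 / (8 n) in the
    exponent.\<close>
  have "exp (- (t\<^sup>2 / real n / 8)) \<le> (1 - \<delta>) ^ N"
  proof -
    have "1 \<le> (1 - \<delta>) * (1 + 2 * \<delta>)"
      using \<delta> mult_nonneg_nonneg[of \<delta> "1 - 2 * \<delta>"] by (simp add: algebra_simps)
    also have "\<dots> \<le> (1 - \<delta>) * exp (2 * \<delta>)"
      using \<delta> exp_ge_add_one_self by (intro mult_left_mono) auto
    finally have "exp (- (2 * \<delta>)) \<le> 1 - \<delta>" by (simp add: exp_minus field_simps)
    then have "exp (- (2 * \<delta>)) ^ N \<le> (1 - \<delta>) ^ N" by (rule power_mono) simp
    moreover have "exp (- (t\<^sup>2 / real n / 8)) \<le> exp (- (2 * \<delta>)) ^ N"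
    proof -
      have "real N * (2 * \<delta>) \<le> t * (2 * \<delta>)" using N \<delta> by (intro mult_right_mono) auto
      also have "\<dots> = t\<^sup>2 / real n / 8" by (simp add: \<delta>_def power2_eq_square)
      finally show ?thesis by (simp flip: exp_of_nat_mult)
    qed
    ultimately show ?thesis by linarith
  qed
  then have "exp (- (t\<^sup>2 / real n / 8)) * (1 / 2) \<le> (1 - \<delta>) ^ N * u N"
    using lower \<delta> by (intro mult_mono) auto
  also have "\<dots> \<le> exp (- (9 / 32 * (t\<^sup>2 / real n)))" using pow[of N] upper by linarith
  finally have "exp (- (t\<^sup>2 / real n / 8)) * (1 / 2) \<le> exp (- (9 / 32 * (t\<^sup>2 / real n)))" .
  moreover have "exp (- (t\<^sup>2 / real n / 8))
      = exp (- (9 / 32 * (t\<^sup>2 / real n))) * exp (5 / 32 * (t\<^sup>2 / real n))"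
    unfolding exp_add[symmetric] by (simp add: field_simps)
  ultimately have "exp (- (9 / 32 * (t\<^sup>2 / real n))) * (exp (5 / 32 * (t\<^sup>2 / real n)) * (1 / 2))
      \<le> exp (- (9 / 32 * (t\<^sup>2 / real n))) * 1" by simp
  then have "exp (5 / 32 * (t\<^sup>2 / real n)) \<le> 2"
    unfolding mult_le_cancel_left_pos[OF exp_gt_zero] by simp
  \<comment> \<open>The gap 5/32 = 9/32 - 1/8 times 64 makes the exponent at least 10, whereas its
    exponential was forced below 2.\<close>
  moreover have "64 \<le> t\<^sup>2 / real n"
  proof -
    have "(8 * sqrt (real n))\<^sup>2 \<le> t\<^sup>2" using t by (intro power_mono) auto
    then show ?thesis using n by (simp add: power_mult_distrib field_simps)
  qed
  ultimately show False
    using exp_ge_add_one_self[of "5 / 32 * (t\<^sup>2 / real n)"] by linarith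
qed

text \<open>Turning one sign of mean -r into one of mean r gains r (u - v), where u and v are the
  tails of the other signs at t - 1 and t + 1. The hazard bound gives u - v >=
  \<open>\<delta>\<close> u, and u is at least the old tail.\<close>

lemma tail_flip:
  assumes r: "0 \<le> r" "r \<le> 1" and \<delta>: "0 \<le> \<delta>"
    and hazard: "tail r a c (t + 1) \<le> (1 - \<delta>) * tail r a c (t - 1)"
  shows "(1 + r * \<delta>) * tail r a (Suc c) t \<le> tail r (Suc a) c t"
proof -
  let ?u = "tail r a c (t - 1)" and ?v = "tail r a c (t + 1)"
  have "?v \<le> ?u" by (rule antimonoD[OF tail_antimono[OF r]]) simp
  then have "(1 + r) / 2 * ?v \<le> (1 + r) / 2 * ?u" using r by (intro mult_left_mono) auto
  then have "tail r a (Suc c) t \<le> ?u" unfolding tail_Suc_right by (simp add: field_simps)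
  then have "r * \<delta> * tail r a (Suc c) t \<le> r * \<delta> * ?u"
    using r \<delta> by (intro mult_left_mono) auto
  also have "\<dots> \<le> r * (?u - ?v)"
    using mult_left_mono[OF hazard r(1)] by (simp add: algebra_simps)
  also have "\<dots> = tail r (Suc a) c t - tail r a (Suc c) t"
    unfolding tail_Suc_right by (simp add: field_simps)
  finally show ?thesis by (simp add: algebra_simps)
qed

lemma tail_mono_plus:
  assumes r: "0 \<le> r" "r \<le> 1" and "a \<le> b" "b \<le> n"
  shows "tail r a (n - a) t \<le> tail r b (n - b) t"
  using assms(3,4)
proof (induction b rule: dec_induct)
  case (step b)
  \<comment> \<open>At \<open>\<delta>\<close> = 0 the hazard hypothesis is just
    antimonotonicity.\<close>
  have "(1 + r * 0) * tail r b (Suc (n - Suc b)) t \<le> tail r (Suc b) (n - Suc b) t"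
    using antimonoD[OF tail_antimono[OF r], of "t - 1" "t + 1" b "n - Suc b"] r
    by (intro tail_flip) auto
  with step show ?case by (simp add: Suc_diff_Suc)
qed simp

text \<open>One factor from \<open>tail_flip\<close> for each of \<open>N\<close> flips. The mean
  bound at the last configuration covers all earlier ones, and a >= n/2 supplies the condition c <=
  a of \<open>tail_hazard\<close>.\<close>

lemma tail_growth:
  assumes r: "0 \<le> r" "r \<le> 1"
    and t: "8 * sqrt (real n) \<le> t" "t \<le> real n" and n: "0 < n"
    and a: "real n \<le> 2 * real a" and N: "a + N \<le> n"
    and mean: "r * (2 * real (a + N) - real n) \<le> t / 4"
  shows "(1 + r * (t / (16 * real n))) ^ N * tail r a (n - a) t
    \<le> tail r (a + N) (n - (a + N)) t"
  using N mean
proof (induction N)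
  case (Suc N)
  \<comment> \<open>The sign being flipped is set aside, so the hazard bound is applied to the other
    n - 1 signs.\<close>
  define c where "c = n - Suc (a + N)"
  define \<delta> where "\<delta> = t / (16 * real n)"
  have c: "n - (a + N) = Suc c" "n - (a + Suc N) = c" "real c = real n - 1 - real (a + N)"
    using Suc.prems(1) by (auto simp: c_def)
  have t0: "0 \<le> t" using t(1) real_sqrt_ge_zero[of "real n"] by linarith
  have le: "r * (2 * real (a + N) + 1 - real n) \<le> r * (2 * real (a + Suc N) - real n)"
    using r by (intro mult_left_mono) auto
  have IH: "(1 + r * \<delta>) ^ N * tail r a (n - a) t \<le> tail r (a + N) (Suc c) t"
    unfolding \<delta>_def c(1)[symmetric]
  proof (rule Suc.IH)
    show "a + N \<le> n" using Suc.prems by simp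
    have "r * (2 * real (a + N) - real n) \<le> r * (2 * real (a + Suc N) - real n)"
      using r by (intro mult_left_mono) auto
    then show "r * (2 * real (a + N) - real n) \<le> t / 4" using Suc.prems by linarith
  qed
  have "tail r (a + N) c (t + 1) \<le> (1 - \<delta>) * tail r (a + N) c (t - 1)"
    unfolding \<delta>_def
  proof (rule tail_hazard[OF r _ _ _ t n])
    show "c \<le> a + N" using a c(3) by linarith
    show "a + N + c \<le> n" using c(3) by linarith
    have "real (a + N) - real c = 2 * real (a + N) + 1 - real n" using c(3) by simp
    then show "r * (real (a + N) - real c) \<le> t / 4" using le Suc.prems(2) by (simp only:)
  qed
  then have "(1 + r * \<delta>) * tail r (a + N) (Suc c) t \<le> tail r (Suc (a + N)) c t"
    using t0 by (intro tail_flip[OF r]) (simp_all add: \<delta>_def)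
  moreover have "(1 + r * \<delta>) * ((1 + r * \<delta>) ^ N * tail r a (n - a) t)
      \<le> (1 + r * \<delta>) * tail r (a + N) (Suc c) t"
    using IH r t0 by (intro mult_left_mono) (auto simp: \<delta>_def)
  ultimately show ?case unfolding c \<delta>_def[symmetric] by (simp add: mult.assoc)
qed simp

section \<open>Symmetric functions on the cube\<close>

definition cube_avg :: "nat \<Rightarrow> ((nat \<Rightarrow> real) \<Rightarrow> real) \<Rightarrow> real" where
  "cube_avg n g = (\<Sum>x\<in>cube n. g x) / 2 ^ n"

lemma finite_cube [simp]: "finite (cube n)"
  by (auto simp: cube_def intro!: finite_PiE)

lemma card_cube: "card (cube n) = 2 ^ n"
  by (simp add: cube_def card_PiE numeral_2_eq_2)

lemma cubeD: "x \<in> cube n \<Longrightarrow> i \<in> {1..n} \<Longrightarrow> x i = -1 \<or> x i = 1"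
  by (auto simp: cube_def PiE_iff)

lemma cube_avg_cong: "(\<And>x. x \<in> cube n \<Longrightarrow> f x = g x) \<Longrightarrow> cube_avg n f = cube_avg n g"
  by (simp add: cube_avg_def)

lemma cube_avg_mono: "(\<And>x. x \<in> cube n \<Longrightarrow> f x \<le> g x) \<Longrightarrow> cube_avg n f \<le> cube_avg n g"
  by (auto simp: cube_avg_def intro!: divide_right_mono sum_mono)

lemma cube_avg_nonneg: "(\<And>x. x \<in> cube n \<Longrightarrow> 0 \<le> f x) \<Longrightarrow> 0 \<le> cube_avg n f"
  by (auto simp: cube_avg_def intro!: divide_nonneg_pos sum_nonneg)

lemma cube_avg_add: "cube_avg n (\<lambda>x. f x + g x) = cube_avg n f + cube_avg n g"
  by (simp add: cube_avg_def sum.distrib add_divide_distrib)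

lemma cube_avg_diff: "cube_avg n (\<lambda>x. f x - g x) = cube_avg n f - cube_avg n g"
  by (simp add: cube_avg_def sum_subtractf diff_divide_distrib)

lemma cube_avg_cmult: "cube_avg n (\<lambda>x. c * f x) = c * cube_avg n f"
  by (simp add: cube_avg_def sum_distrib_left)

lemma cube_avg_sum: "cube_avg n (\<lambda>x. \<Sum>i\<in>I. f i x) = (\<Sum>i\<in>I. cube_avg n (f i))"
  unfolding cube_avg_def sum_divide_distrib[symmetric] by (subst sum.swap) simp

lemma cube_avg_const: "cube_avg n (\<lambda>_. c) = c"
  by (simp add: cube_avg_def card_cube)

lemma cube_avg_Cauchy_Schwarz:
  "(cube_avg n (\<lambda>x. f x * g x))\<^sup>2 \<le> cube_avg n (\<lambda>x. (f x)\<^sup>2) * cube_avg n (\<lambda>x. (g x)\<^sup>2)"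
  using Cauchy_Schwarz_ineq_sum[of f g "cube n"]
  by (simp add: cube_avg_def power_divide power2_eq_square[of "2 ^ n"] divide_right_mono)

lemma cube_avg_prod:
  "cube_avg n (\<lambda>x. \<Prod>i=1..n. f i (x i)) = (\<Prod>i=1..n. (f i (-1) + f i 1) / 2)"
proof -
  have "(\<Sum>x\<in>cube n. \<Prod>i=1..n. f i (x i)) = (\<Prod>i=1..n. \<Sum>v\<in>{-1, 1}. f i v)"
    unfolding cube_def by (rule prod_sum_PiE[symmetric]) auto
  then show ?thesis by (simp add: cube_avg_def prod_dividef)
qed

text \<open>Orthonormality of the Walsh characters: the average factorises, and a coordinate lying
  in exactly one of the two sets contributes mean 0.\<close>

lemma cube_avg_chi_mult:
  assumes S: "S \<subseteq> {1..n}" and T: "T \<subseteq> {1..n}"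
  shows "cube_avg n (\<lambda>x. prod x S * prod x T) = (if S = T then 1 else 0)"
proof -
  have *: "prod x A = (\<Prod>i=1..n. if i \<in> A then x i else 1)" if "A \<subseteq> {1..n}" for A and x :: "nat \<Rightarrow> real"
    using that by (simp add: prod.If_cases Int_absorb1)
  have "cube_avg n (\<lambda>x. prod x S * prod x T)
    = cube_avg n (\<lambda>x. \<Prod>i=1..n. (if i \<in> S then x i else 1) * (if i \<in> T then x i else 1))"
    unfolding *[OF S] *[OF T] prod.distrib[symmetric] ..
  also have "\<dots> = (\<Prod>i=1..n. ((if i \<in> S then -1 else 1) * (if i \<in> T then -1 else 1)
      + (if i \<in> S then 1 else 1) * (if i \<in> T then 1 else 1)) / 2)"
    by (rule cube_avg_prod[of n "\<lambda>i v. (if i \<in> S then v else 1) * (if i \<in> T then v else 1)"])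
  also have "\<dots> = (\<Prod>i=1..n. if i \<in> S \<longleftrightarrow> i \<in> T then 1 else 0)"
    by (intro prod.cong) auto
  also have "\<dots> = (if S = T then 1 else 0)"
    using S T by (auto intro!: prod.neutral)
  finally show ?thesis .
qed

lemma cube_avg_exp_sum: "cube_avg n (\<lambda>x. exp (l * (\<Sum>i=1..n. x i))) = cosh l ^ n"
  using cube_avg_prod[of n "\<lambda>_ v. exp (l * v)"]
  by (simp add: sum_distrib_left exp_sum cosh_def add.commute)

section \<open>Elementary symmetric polynomials and their recurrence\<close>

definition esym :: "nat \<Rightarrow> nat \<Rightarrow> (nat \<Rightarrow> real) \<Rightarrow> real" where
  "esym n s x = (\<Sum>S | S \<subseteq> {1..n} \<and> card S = s. prod x S)"

lemma cube_avg_esym_mult: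
  "cube_avg n (\<lambda>x. esym n s x * esym n t x) = (if s = t then real (n choose s) else 0)"
proof -
  have "cube_avg n (\<lambda>x. esym n s x * esym n t x)
    = (\<Sum>S | S \<subseteq> {1..n} \<and> card S = s. \<Sum>T | T \<subseteq> {1..n} \<and> card T = t. cube_avg n (\<lambda>x. prod x S * prod x T))"
    unfolding esym_def sum_product cube_avg_sum ..
  also have "\<dots> = (\<Sum>S | S \<subseteq> {1..n} \<and> card S = s. \<Sum>T | T \<subseteq> {1..n} \<and> card T = t. if S = T then 1 else 0)"
    by (intro sum.cong refl) (simp add: cube_avg_chi_mult)
  also have "\<dots> = (\<Sum>S | S \<subseteq> {1..n} \<and> card S = s. if s = t then 1 else 0)"
    by (intro sum.cong refl) (simp add: sum.delta)
  also have "\<dots> = (if s = t then real (n choose s) else 0)"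
    using n_subsets[of "{1..n}" s] by simp
  finally show ?thesis .
qed

lemma esym_0: "esym n 0 x = 1"
proof -
  have "{S. S \<subseteq> {1..n} \<and> card S = 0} = {{}}"
    by (auto simp: card_eq_0_iff dest: finite_subset)
  then show ?thesis by (simp add: esym_def)
qed

lemma esym_0_Suc: "esym 0 (Suc s) x = 0"
proof -
  have "{S::nat set. S \<subseteq> {} \<and> card S = Suc s} = {}" by auto
  then show ?thesis by (simp add: esym_def)
qed

lemma esym_Suc_Suc: "esym (Suc n) (Suc s) x = esym n (Suc s) x + x (Suc n) * esym n s x"
proof -
  let ?A = "{S. S \<subseteq> {1..n} \<and> card S = Suc s}" and ?B = "{S. S \<subseteq> {1..n} \<and> card S = s}"
  have fin: "finite {S. S \<subseteq> {1..m} \<and> card S = j}" for m j :: nat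
    by (rule finite_subset[of _ "Pow {1..m}"]) auto
  have notin: "Suc n \<notin> S" "finite S" if "S \<subseteq> {1..n}" for S
    using that finite_subset by auto
  have eq: "{S. S \<subseteq> {1..Suc n} \<and> card S = Suc s} = ?A \<union> insert (Suc n) ` ?B"
  proof (intro equalityI subsetI)
    fix S assume S: "S \<in> {S. S \<subseteq> {1..Suc n} \<and> card S = Suc s}"
    show "S \<in> ?A \<union> insert (Suc n) ` ?B"
    proof (cases "Suc n \<in> S")
      case True
      have "S - {Suc n} \<in> ?B" using S True by (auto simp: atLeastAtMostSuc_conv)
      moreover have "S = insert (Suc n) (S - {Suc n})" using True by auto
      ultimately show ?thesis by blast
    next
      case False
      then show ?thesis using S by (auto simp: atLeastAtMostSuc_conv)
    qed
  qed (auto simp: card_insert_disjoint notin)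
  have inj: "inj_on (insert (Suc n)) ?B"
    by (intro inj_onI) (metis (no_types, lifting) insert_ident mem_Collect_eq notin(1))
  have "esym (Suc n) (Suc s) x = sum (prod x) ?A + sum (prod x) (insert (Suc n) ` ?B)"
    unfolding esym_def eq by (rule sum.union_disjoint) (auto simp: fin)
  also have "sum (prod x) (insert (Suc n) ` ?B) = (\<Sum>S\<in>?B. x (Suc n) * prod x S)"
    unfolding sum.reindex[OF inj] by (intro sum.cong) (auto simp: notin)
  finally show ?thesis by (simp add: esym_def sum_distrib_left)
qed

lemma esym_1: "esym n 1 x = (\<Sum>i=1..n. x i)"
  unfolding One_nat_def by (induction n) (simp_all add: esym_0_Suc esym_Suc_Suc esym_0)

text \<open>The three-term recurrence of the Krawtchouk polynomials. As x i squares to 1,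
  multiplying a monomial of degree s + 1 by x i adds or deletes the index i; each monomial of degree
  s + 2 arises s + 2 times, each of degree s arises n - s times.\<close>

lemma esym_recurrence:
  assumes "\<And>i. i \<in> {1..n} \<Longrightarrow> x i * x i = 1"
  shows "real (s + 2) * esym n (s + 2) x
    = (\<Sum>i=1..n. x i) * esym n (s + 1) x - (real n - real s) * esym n s x"
  using assms
proof (induction n arbitrary: s)
  case 0
  then show ?case by (cases s) (simp_all add: esym_0_Suc)
next
  case (Suc n)
  let ?b = "\<Sum>i=1..n. x i" and ?y = "x (Suc n)"
  have IH: "real (s + 2) * esym n (Suc (Suc s)) x = ?b * esym n (Suc s) x - (real n - real s) * esym n s x" for s
    using Suc.IH[of s] Suc.prems by simp
  have y: "?y * ?y = 1" using Suc.prems[of "Suc n"] by simp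
  have y': "?y * (?y * z) = z" for z using y by (simp flip: mult.assoc)
  show ?case
  proof (cases s)
    case 0
    show ?thesis using IH[of 0] y esym_1[of n x]
      by (simp add: 0 esym_Suc_Suc esym_0 numeral_2_eq_2 algebra_simps y')
  next
    case (Suc j)
    have e: "esym (Suc n) (s + 2) x = esym n (Suc (Suc s)) x + ?y * esym n (Suc s) x"
      "esym (Suc n) (s + 1) x = esym n (Suc s) x + ?y * esym n s x"
      "esym (Suc n) s x = esym n s x + ?y * esym n j x"
      by (simp_all add: esym_Suc_Suc Suc)
    have "real (s + 2) * esym (Suc n) (s + 2) x
      = real (s + 2) * esym n (Suc (Suc s)) x + ?y * (real (s + 1) * esym n (Suc s) x) + ?y * esym n (Suc s) x"
      unfolding e by (simp add: algebra_simps)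
    also have "real (s + 1) * esym n (Suc s) x = ?b * esym n s x - (real n - real j) * esym n j x"
      using IH[of j] by (simp add: Suc)
    also note IH[of s]
    finally show ?thesis unfolding e by (simp add: Suc algebra_simps y y')
  qed
qed

text \<open>The recurrence computes every degree from the coordinate sum, starting from degrees 0
  and 1.\<close>

lemma esym_eq_if_sum_eq:
  assumes "x \<in> cube n" "y \<in> cube n" "(\<Sum>i=1..n. x i) = (\<Sum>i=1..n. y i)"
  shows "esym n s x = esym n s y"
proof (induction s rule: less_induct)
  case (less s)
  have sq: "z i * z i = 1" if "z \<in> cube n" "i \<in> {1..n}" for z i
    using cubeD[OF that] by auto
  show ?case
  proof (cases "s < 2")
    case True
    then consider "s = 0" | "s = 1" by linarith
    then show ?thesis using assms(3) by cases (simp_all add: esym_0 esym_1 del: One_nat_def)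
  next
    case False
    define j where "j = s - 2"
    have s: "s = j + 2" using False by (simp add: j_def)
    have rec: "real (j + 2) * esym n (j + 2) z
        = (\<Sum>i=1..n. z i) * esym n (j + 1) z - (real n - real j) * esym n j z" if "z \<in> cube n" for z
      by (rule esym_recurrence) (rule sq[OF that])
    have "esym n j x = esym n j y" "esym n (j + 1) x = esym n (j + 1) y"
      using less[of j] less[of "j + 1"] by (simp_all add: s)
    then have "real (j + 2) * esym n (j + 2) x = real (j + 2) * esym n (j + 2) y"
      by (simp only: rec[OF assms(1)] rec[OF assms(2)] assms(3))
    then show ?thesis by (simp add: s)
  qed
qed

section \<open>Fourier coefficients of symmetric functions\<close>

lemma cube_permute:
  assumes pi: "p permutes {1..n}" shows "bij_betw (\<lambda>x. x \<circ> p) (cube n) (cube n)"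
proof -
  have *: "x \<circ> q \<in> cube n" if "x \<in> cube n" "q permutes {1..n}" for x q
    using that permutes_in_image[OF that(2)] permutes_not_in[OF that(2)]
    by (auto simp: cube_def PiE_iff extensional_def)
  show ?thesis
  proof (rule bij_betw_byWitness[where f' = "\<lambda>x. x \<circ> inv_into UNIV p"])
    show "(\<lambda>x. x \<circ> p) ` cube n \<subseteq> cube n" using *[OF _ pi] by auto
    show "(\<lambda>x. x \<circ> inv_into UNIV p) ` cube n \<subseteq> cube n" using *[OF _ permutes_inv[OF pi]] by auto
  qed (auto simp: o_assoc[symmetric] permutes_inv_o[OF pi])
qed

lemma permutation_moving_subset:
  assumes "finite A" "S \<subseteq> A" "T \<subseteq> A" "card S = card T"
  obtains p where "p permutes A" "p ` S = T"
proof -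
  have fin: "finite S" "finite T" using assms finite_subset by auto
  obtain f where f: "bij_betw f S T"
    using finite_same_card_bij[OF fin assms(4)] by auto
  have "card (A - S) = card (A - T)"
    using assms fin by (simp add: card_Diff_subset)
  then obtain g where g: "bij_betw g (A - S) (A - T)"
    using finite_same_card_bij[of "A - S" "A - T"] assms(1) by auto
  define p where "p i = (if i \<in> A then if i \<in> S then f i else g i else i)" for i
  have pS: "bij_betw p S T" using f assms(2) by (subst bij_betw_cong[of S p f]) (auto simp: p_def)
  have "bij_betw p (A - S) (A - T)"
    using g by (subst bij_betw_cong[of "A - S" p g]) (auto simp: p_def)
  from bij_betw_combine[OF pS this] have "bij_betw p A A"
    using assms by (simp add: Un_absorb1)
  then have "p permutes A" by (intro bij_imp_permutes) (auto simp: p_def)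
  with pS show ?thesis by (intro that) (auto simp: bij_betw_def)
qed

text \<open>A permutation carrying S to T preserves f and the uniform measure, so all coefficients
  at one level agree, and pairing with \<open>esym\<close> adds them up.\<close>

lemma symmetric_Fourier_coefficient:
  assumes sym: "\<And>x y. x \<in> cube n \<Longrightarrow> y \<in> cube n \<Longrightarrow> (\<Sum>i=1..n. x i) = (\<Sum>i=1..n. y i) \<Longrightarrow> f x = f y"
    and S: "S \<subseteq> {1..n}"
  shows "cube_avg n (\<lambda>x. f x * esym n (card S) x)
    = real (n choose card S) * cube_avg n (\<lambda>x. f x * prod x S)"
proof -
  have same: "cube_avg n (\<lambda>x. f x * prod x T) = cube_avg n (\<lambda>x. f x * prod x S)"
    if T: "T \<subseteq> {1..n}" "card T = card S" for T
  proof -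
    obtain p where p: "p permutes {1..n}" "p ` S = T"
      using permutation_moving_subset[of "{1..n}" S T] S T by auto
    note bij = cube_permute[OF p(1)]
    have inj: "inj_on p S" using p(1) by (auto intro: inj_on_subset[OF permutes_inj])
    have "(\<Sum>x\<in>cube n. f x * prod x S) = (\<Sum>x\<in>cube n. f (x \<circ> p) * prod (x \<circ> p) S)"
      by (rule sum.reindex_bij_betw[OF bij, symmetric])
    also have "\<dots> = (\<Sum>x\<in>cube n. f x * prod x T)"
    proof (intro sum.cong refl)
      fix x assume x: "x \<in> cube n"
      have "(\<Sum>i=1..n. x i) = (\<Sum>i=1..n. (x \<circ> p) i)"
        using sum.permute[OF p(1), of x] by simp
      moreover have "x \<circ> p \<in> cube n" using bij_betwE[OF bij] x by auto
      ultimately have "f (x \<circ> p) = f x" using sym x by metis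
      moreover have "prod (x \<circ> p) S = prod x T"
        using prod.reindex[OF inj, of x] p(2) by simp
      ultimately show "f (x \<circ> p) * prod (x \<circ> p) S = f x * prod x T" by simp
    qed
    finally show ?thesis by (simp add: cube_avg_def)
  qed
  have "cube_avg n (\<lambda>x. f x * esym n (card S) x)
    = (\<Sum>T | T \<subseteq> {1..n} \<and> card T = card S. cube_avg n (\<lambda>x. f x * prod x T))"
    unfolding esym_def sum_distrib_left cube_avg_sum ..
  also have "\<dots> = (\<Sum>T | T \<subseteq> {1..n} \<and> card T = card S. cube_avg n (\<lambda>x. f x * prod x S))"
    by (intro sum.cong refl same) auto
  also have "\<dots> = real (n choose card S) * cube_avg n (\<lambda>x. f x * prod x S)"
    using n_subsets[of "{1..n}" "card S"] by simp
  finally show ?thesis .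
qed

section \<open>Growth of the elementary symmetric polynomials\<close>

lemma cube_sq: "x \<in> cube n \<Longrightarrow> i \<in> {1..n} \<Longrightarrow> x i * x i = 1"
  using cubeD by fastforce

text \<open>Induction along the recurrence with Y = |b| + 2 R, R = sqrt (n k). For j + 1 <= 4 k one
  has n (j+1) <= (2 R)^2 <= 2 R Y, so the term of degree j fits into the summand 2 R of Y.\<close>

lemma abs_esym_le:
  assumes x: "x \<in> cube n" and k: "0 < k" and s: "s \<le> n" "s \<le> 4 * k"
  shows "\<bar>esym n s x\<bar> \<le> (\<bar>\<Sum>i=1..n. x i\<bar> + 2 * sqrt (real n * real k)) ^ s / fact s"
  using s
proof (induction s rule: less_induct)
  case (less s)
  let ?b = "\<Sum>i=1..n. x i"
  define R Y where "R = sqrt (real n * real k)" and "Y = \<bar>?b\<bar> + 2 * R"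
  have R0: "0 \<le> R" and RR: "R * R = real n * real k" by (simp_all add: R_def)
  have Y: "0 \<le> Y" "2 * R \<le> Y" using R0 by (simp_all add: Y_def)
  have "\<bar>esym n s x\<bar> \<le> Y ^ s / fact s"
  proof (cases "s < 2")
    case True
    then consider "s = 0" | "s = 1" by linarith
    then show ?thesis
    proof cases
      case 2
      then show ?thesis using R0 by (simp add: esym_1 Y_def del: One_nat_def)
    qed (simp add: esym_0)
  next
    case False
    define j where "j = s - 2"
    have sj: "s = j + 2" using False by (simp add: j_def)
    have IH: "\<bar>esym n (j + 1) x\<bar> \<le> Y ^ (j + 1) / fact (j + 1)" "\<bar>esym n j x\<bar> \<le> Y ^ j / fact j"
      using less.IH[of "j + 1"] less.IH[of j] less.prems unfolding R_def Y_def sj by auto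
    have "real n * (Y ^ j / fact j) = real n * real (j + 1) * Y ^ j / fact (j + 1)"
    proof -
      have "real n * (Y ^ j / F) = real n * m * Y ^ j / (m * F)" if "m \<noteq> 0" "F \<noteq> 0" for m F :: real
        using that by (simp add: field_simps)
      from this[of "real (j + 1)" "fact j"] show ?thesis by simp
    qed
    also have "\<dots> \<le> 2 * R * Y ^ (j + 1) / fact (j + 1)"
    proof (intro divide_right_mono)
      have "real n * real (j + 1) \<le> real n * real (4 * k)"
        using less.prems sj by (intro mult_left_mono) auto
      also have "\<dots> = 2 * R * (2 * R)" using RR by simp
      also have "\<dots> \<le> 2 * R * Y" using Y R0 by (intro mult_left_mono) auto
      finally have "real n * real (j + 1) * Y ^ j \<le> 2 * R * Y * Y ^ j"
        using Y by (intro mult_right_mono) auto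
      then show "real n * real (j + 1) * Y ^ j \<le> 2 * R * Y ^ (j + 1)" by (simp add: mult.assoc)
    qed simp
    finally have bound: "real n * (Y ^ j / fact j) \<le> 2 * R * Y ^ (j + 1) / fact (j + 1)" .
    have "real (j + 2) * \<bar>esym n (j + 2) x\<bar> = \<bar>real (j + 2) * esym n (j + 2) x\<bar>"
      by (simp add: abs_mult)
    also have "\<dots> = \<bar>?b * esym n (j + 1) x - (real n - real j) * esym n j x\<bar>"
      by (subst esym_recurrence) (auto intro: cube_sq[OF x])
    also have "\<dots> \<le> \<bar>?b\<bar> * \<bar>esym n (j + 1) x\<bar> + \<bar>real n - real j\<bar> * \<bar>esym n j x\<bar>"
      unfolding abs_mult[symmetric] by (rule abs_triangle_ineq4)
    also have "\<dots> \<le> \<bar>?b\<bar> * (Y ^ (j + 1) / fact (j + 1)) + real n * (Y ^ j / fact j)"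
      using IH less.prems sj by (intro add_mono mult_mono) auto
    also have "\<dots> \<le> \<bar>?b\<bar> * (Y ^ (j + 1) / fact (j + 1)) + 2 * R * Y ^ (j + 1) / fact (j + 1)"
      using bound by (rule add_left_mono)
    also have "\<dots> = (\<bar>?b\<bar> + 2 * R) * Y ^ (j + 1) / fact (j + 1)"
      by (simp add: add_divide_distrib distrib_right)
    also have "(\<bar>?b\<bar> + 2 * R) * Y ^ (j + 1) = Y ^ (j + 2)"
      unfolding Y_def[symmetric] by simp
    also have "Y ^ (j + 2) / fact (j + 1) = real (j + 2) * (Y ^ (j + 2) / fact (j + 2))"
    proof -
      have *: "z / F = m * (z / (m * F))" if "m \<noteq> 0" for m z F :: real
        using that by simp
      have "(fact (j + 2) :: real) = real (j + 2) * fact (j + 1)" by simp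
      then show ?thesis by (simp only:, intro *, simp)
    qed
    finally have "real (j + 2) * \<bar>esym n (j + 2) x\<bar> \<le> real (j + 2) * (Y ^ (j + 2) / fact (j + 2))" .
    then show ?thesis unfolding sj by (rule mult_left_le_imp_le) simp
  qed
  then show ?case by (simp add: Y_def R_def)
qed

text \<open>Every factor n - i of the falling factorial is at least n/2.\<close>

lemma binomial_ge_half_power:
  assumes "2 * s \<le> n" shows "(real n / 2) ^ s / fact s \<le> real (n choose s)"
  using assms
proof (induction s)
  case (Suc s)
  have "Suc s * (n choose Suc s) = (n - s) * (n choose s)"
    using Suc_times_binomial_add[of s "n - Suc s"] Suc.prems
    by (metis Suc_times_binomial_eq binomial_absorb_comp binomial_absorption)
  then have *: "real (Suc s) * real (n choose Suc s) = (real n - real s) * real (n choose s)"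
    using Suc.prems by (metis (mono_tags, lifting) Suc_leD Suc_le_lessD add_leD1 less_imp_le mult_2 of_nat_diff of_nat_mult)
  have "(real n / 2) * ((real n / 2) ^ s / fact s) \<le> (real n - real s) * real (n choose s)"
    using Suc by (intro mult_mono) auto
  then have "(real n / 2) * ((real n / 2) ^ s / fact s) / real (Suc s) \<le> real (n choose Suc s)"
    unfolding *[symmetric] by (subst pos_divide_le_eq) (simp_all only: mult.commute of_nat_0_less_iff zero_less_Suc)
  moreover have "(real n / 2) ^ Suc s / fact (Suc s) = (real n / 2) * ((real n / 2) ^ s / fact s) / real (Suc s)"
    by simp
  ultimately show ?case by (simp only:)
qed simp

text \<open>The diagonal of the reproducing kernel of the symmetric polynomials of degree below d;
  its reciprocal is the classical Christoffel function. By Cauchy--Schwarz it bounds the squared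
  value at x of such a polynomial of norm 1.\<close>

definition christoffel :: "nat \<Rightarrow> nat \<Rightarrow> (nat \<Rightarrow> real) \<Rightarrow> real" where
  "christoffel n d x = (\<Sum>s<d. (esym n s x)\<^sup>2 / real (n choose s))"

text \<open>The two preceding bounds give (2 Y^2 / n)^s / s! for the term of degree s. Its
  k-dependent part sums to at most exp (2 k), and the rest is at most (\<beta> + 2)^(4 k), hence at
  most exp (4 k (\<beta> + 1)).\<close>

lemma christoffel_le:
  assumes x: "x \<in> cube n" and k: "0 < k" "4 * k \<le> n"
  shows "christoffel n (2 * k) x
    \<le> exp (6 * real k + 4 * sqrt (real k / real n) * \<bar>\<Sum>i=1..n. x i\<bar>)"
proof -
  define b where "b = \<bar>\<Sum>i=1..n. x i\<bar>"
  define \<theta> where "\<theta> = sqrt (real k / real n)"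
  define Y where "Y = b + 2 * sqrt (real n * real k)"
  \<comment> \<open>The coordinate sum in units of sqrt (n k), so that k \<beta> = \<theta>
    b.\<close>
  define \<beta> where "\<beta> = b / sqrt (real n * real k)"
  have n: "0 < real n" using k by simp
  have b0: "0 \<le> b" by (simp add: b_def)
  have \<beta>0: "0 \<le> \<beta>" using b0 by (simp add: \<beta>_def)
  have R: "0 < sqrt (real n * real k)" "sqrt (real n * real k) ^ 2 = real n * real k" using n k by simp_all
  have Rb: "sqrt (real n * real k) * \<beta> = b"
    using less_imp_neq[OF R(1)] unfolding \<beta>_def by (metis nonzero_mult_div_cancel_left times_divide_eq_right)
  then have Y\<beta>: "Y = sqrt (real n * real k) * (\<beta> + 2)"
    unfolding Y_def distrib_left by (simp only: mult.commute)
  have Y2: "2 * Y\<^sup>2 / real n = 2 * real k * (\<beta> + 2)\<^sup>2"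
    unfolding Y\<beta> power_mult_distrib R(2) using n by simp
  have \<beta>\<theta>: "real k * \<beta> = \<theta> * b"
  proof -
    have "real k = \<theta> * sqrt (real n * real k)"
      unfolding \<theta>_def real_sqrt_mult[symmetric] using n by simp
    then show ?thesis using Rb by (metis mult.assoc)
  qed
  define E where "E = exp (4 * real k * (\<beta> + 1))"
  have "(esym n s x)\<^sup>2 / real (n choose s) \<le> (2 * real k) ^ s / fact s * E" if s: "s < 2 * k" for s
  proof -
    have 1: "(esym n s x)\<^sup>2 \<le> (Y ^ s / fact s)\<^sup>2"
    proof -
      have "\<bar>esym n s x\<bar> \<le> Y ^ s / fact s"
        using abs_esym_le[OF x k(1), of s] s k unfolding Y_def b_def by simp
      then have "\<bar>esym n s x\<bar>\<^sup>2 \<le> (Y ^ s / fact s)\<^sup>2" by (intro power_mono) auto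
      then show ?thesis by simp
    qed
    have 2: "(real n / 2) ^ s / fact s \<le> real (n choose s)"
      using s k by (intro binomial_ge_half_power) simp
    have "(esym n s x)\<^sup>2 / real (n choose s) \<le> (Y ^ s / fact s)\<^sup>2 / ((real n / 2) ^ s / fact s)"
      using 1 2 n by (intro frac_le) auto
    also have "\<dots> = (2 * Y\<^sup>2 / real n) ^ s / fact s"
      using n by (simp add: power2_eq_square power_mult_distrib power_divide field_simps)
    also have "\<dots> = (2 * real k) ^ s / fact s * (\<beta> + 2) ^ (2 * s)"
      unfolding Y2 power_mult_distrib[of "2 * real k"] by (simp add: power_mult)
    also have "\<dots> \<le> (2 * real k) ^ s / fact s * E"
    proof (intro mult_left_mono)
      have "(\<beta> + 2) ^ (2 * s) \<le> (\<beta> + 2) ^ (4 * k)"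
        using s \<beta>0 by (intro power_increasing) auto
      also have "\<dots> \<le> exp (\<beta> + 1) ^ (4 * k)"
        using exp_ge_add_one_self[of "\<beta> + 1"] \<beta>0 by (intro power_mono) auto
      also have "\<dots> = E" by (simp add: E_def algebra_simps flip: exp_of_nat_mult)
      finally show "(\<beta> + 2) ^ (2 * s) \<le> E" .
    qed simp
    finally show ?thesis .
  qed
  then have "christoffel n (2 * k) x \<le> (\<Sum>s<2 * k. (2 * real k) ^ s / fact s * E)"
    unfolding christoffel_def by (intro sum_mono) auto
  also have "\<dots> = (\<Sum>s<2 * k. (2 * real k) ^ s /\<^sub>R fact s) * E"
    unfolding sum_distrib_right by (intro sum.cong refl) (simp add: field_simps)
  also have "\<dots> \<le> exp (2 * real k) * E"
  proof (intro mult_right_mono)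
    have "(\<Sum>s<2 * k. (2 * real k) ^ s /\<^sub>R fact s) \<le> (\<Sum>s. (2 * real k) ^ s /\<^sub>R fact s)"
      by (intro sum_le_suminf summable_exp_generic) auto
    then show "(\<Sum>s<2 * k. (2 * real k) ^ s /\<^sub>R fact s) \<le> exp (2 * real k)"
      by (simp add: exp_def)
  qed (simp add: E_def)
  also have "\<dots> = exp (6 * real k + 4 * (real k * \<beta>))"
    by (simp add: E_def algebra_simps flip: exp_add)
  finally show ?thesis by (simp add: \<beta>\<theta> \<theta>_def b_def mult.assoc)
qed

lemma cube_avg_exp_abs_sum_le:
  assumes "0 \<le> l"
  shows "cube_avg n (\<lambda>x. exp (l * \<bar>\<Sum>i=1..n. x i\<bar>)) \<le> 2 * exp (real n * l\<^sup>2 / 2)"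
proof -
  have "cube_avg n (\<lambda>x. exp (l * \<bar>\<Sum>i=1..n. x i\<bar>))
    \<le> cube_avg n (\<lambda>x. exp (l * (\<Sum>i=1..n. x i)) + exp (- l * (\<Sum>i=1..n. x i)))"
    by (rule cube_avg_mono) (auto simp: abs_if)
  also have "\<dots> = 2 * cosh l ^ n"
    unfolding cube_avg_add cube_avg_exp_sum by simp
  also have "\<dots> \<le> 2 * exp (l\<^sup>2 / 2) ^ n"
    by (intro mult_left_mono power_mono cosh_le_exp_square) (auto simp: less_imp_le)
  also have "\<dots> = 2 * exp (real n * l\<^sup>2 / 2)"
    by (simp flip: exp_of_nat_mult)
  finally show ?thesis .
qed

section \<open>A density supported on small sums\<close>

text \<open>An injective square system is solvable. It serves for a Gram matrix, whose injectivity
  is positive definiteness.\<close>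

lemma nonsingular_system_solvable:
  fixes G :: "nat \<Rightarrow> nat \<Rightarrow> real" and c :: "nat \<Rightarrow> real"
  assumes inj: "\<And>v. (\<And>s. s < d \<Longrightarrow> (\<Sum>t<d. G s t * v t) = 0) \<Longrightarrow> (\<forall>t<d. v t = 0)"
  obtains u where "\<And>s. s < d \<Longrightarrow> (\<Sum>t<d. G s t * u t) = c s"
proof -
  define A where "A = Matrix.mat d d (\<lambda>(s, t). G s t)"
  have A: "A \<in> carrier_mat d d" by (simp add: A_def)
  have mult: "vec_index (A *\<^sub>v v) s = (\<Sum>t<d. G s t * vec_index v t)"
    if "v \<in> carrier_vec d" "s < d" for v s
    using that by (simp add: A_def scalar_prod_def lessThan_atLeast0)
  have "det A \<noteq> 0"
  proof
    assume "det A = 0"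
    then obtain v where v: "v \<in> carrier_vec d" "v \<noteq> 0\<^sub>v d" "A *\<^sub>v v = 0\<^sub>v d"
      using det_0_iff_vec_prod_zero_field[OF A] by auto
    have "(\<Sum>t<d. G s t * vec_index v t) = 0" if "s < d" for s
      using mult[OF v(1) that] v(3) that by simp
    then have "\<forall>t<d. vec_index v t = 0" by (rule inj)
    then have "v = 0\<^sub>v d" using v(1) by auto
    with v(2) show False by simp
  qed
  from det_non_zero_imp_unit[OF A this, of "()"]
  obtain B where B: "B \<in> carrier_mat d d" "A * B = 1\<^sub>m d"
    unfolding Units_def ring_mat_def by auto
  define w where "w = B *\<^sub>v Matrix.vec d c"
  have w: "w \<in> carrier_vec d" using B by (simp add: w_def)
  have "A *\<^sub>v w = (A * B) *\<^sub>v Matrix.vec d c"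
    unfolding w_def by (rule assoc_mult_mat_vec[symmetric, OF A B(1)]) simp
  then have "A *\<^sub>v w = Matrix.vec d c" using B by simp
  then have "(\<Sum>t<d. G s t * vec_index w t) = c s" if "s < d" for s
    using mult[OF w that] that by simp
  then show ?thesis by (rule that)
qed

text \<open>The density is \<open>inn\<close> times a symmetric polynomial \<open>P u\<close>, with
  \<open>u\<close> solving the linear system for the prescribed coefficients below level 2 k. Since
  \<open>P u\<close> is within 1 of the constant 1 on the support, the density lies in [0,2];
  Bessel's inequality then controls the higher levels.\<close>

lemma bounded_support_density:
  assumes k: "0 < k" "4 * k \<le> n"
  obtains f :: "(nat \<Rightarrow> real) \<Rightarrow> real" where
    "\<And>x. x \<in> cube n \<Longrightarrow> 0 \<le> f x"
    "\<And>x. x \<in> cube n \<Longrightarrow> 12 * sqrt (real n * real k) < \<bar>\<Sum>i=1..n. x i\<bar> \<Longrightarrow> f x = 0"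
    "cube_avg n f = 1"
    "\<And>S. S \<subseteq> {1..n} \<Longrightarrow> S \<noteq> {} \<Longrightarrow> card S < 2 * k \<Longrightarrow> cube_avg n (\<lambda>x. f x * prod x S) = 0"
    "\<And>S. S \<subseteq> {1..n} \<Longrightarrow> (cube_avg n (\<lambda>x. f x * prod x S))\<^sup>2 * real (n choose card S) \<le> 4"
proof -
  define b where "b x = (\<Sum>i=1..n. x i)" for x :: "nat \<Rightarrow> real"
  define \<theta> where "\<theta> = sqrt (real k / real n)"
  define \<alpha> where "\<alpha> = 12 * sqrt (real n * real k)"
  define inn where "inn x = (if \<bar>b x\<bar> \<le> \<alpha> then 1 else 0 :: real)" for x
  define out where "out x = 1 - inn x" for x
  define d where "d = 2 * k"
  \<comment> \<open>Both the prescribed coefficients of the density and the coefficient vector of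
    the constant polynomial 1.\<close>
  define c where "c s = (if s = 0 then 1 else 0 :: real)" for s :: nat
  define \<phi> where "\<phi> s x = esym n s x / sqrt (real (n choose s))" for s x
  define P where "P v x = (\<Sum>s<d. v s * \<phi> s x)" for v x
  have n: "0 < real n" using k by simp
  have \<theta>0: "0 \<le> \<theta>" by (simp add: \<theta>_def)
  have \<theta>\<alpha>: "\<theta> * \<alpha> = 12 * real k"
    unfolding \<theta>_def \<alpha>_def using n by (simp flip: real_sqrt_mult)
  have \<theta>2: "real n * \<theta>\<^sup>2 = real k" using n by (simp add: \<theta>_def)
  have inn_sq: "inn x * inn x = inn x" "out x * out x = out x" "0 \<le> inn x" "0 \<le> out x" for x
    by (simp_all add: inn_def out_def)
  have choose_pos: "0 < real (n choose s)" if "s < d" for s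
    using that k by (simp add: d_def)

  have orth: "cube_avg n (\<lambda>x. \<phi> s x * \<phi> t x) = (if s = t then 1 else 0)" if "s < d" "t < d" for s t
  proof -
    have "cube_avg n (\<lambda>x. \<phi> s x * \<phi> t x)
      = cube_avg n (\<lambda>x. (1 / (sqrt (real (n choose s)) * sqrt (real (n choose t)))) * (esym n s x * esym n t x))"
      by (intro cube_avg_cong) (simp add: \<phi>_def)
    then show ?thesis
      unfolding cube_avg_cmult cube_avg_esym_mult using choose_pos[OF that(1)] by simp
  qed
  have P_mult: "cube_avg n (\<lambda>x. P v x * P w x) = (\<Sum>s<d. v s * w s)" for v w
  proof -
    have "cube_avg n (\<lambda>x. P v x * P w x)
      = (\<Sum>s<d. \<Sum>t<d. (v s * w t) * cube_avg n (\<lambda>x. \<phi> s x * \<phi> t x))"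
      unfolding P_def sum_product cube_avg_sum cube_avg_cmult[symmetric]
      by (intro sum.cong refl cube_avg_cong) simp
    also have "\<dots> = (\<Sum>s<d. \<Sum>t<d. if s = t then v s * w t else 0)"
      by (intro sum.cong refl) (simp add: orth)
    also have "\<dots> = (\<Sum>s<d. v s * w s)" by simp
    finally show ?thesis .
  qed
  have P_sq: "(P v x)\<^sup>2 \<le> (\<Sum>s<d. (v s)\<^sup>2) * christoffel n d x" for v x
  proof -
    have "(P v x)\<^sup>2 \<le> (\<Sum>s<d. (v s)\<^sup>2) * (\<Sum>s<d. (\<phi> s x)\<^sup>2)"
      unfolding P_def by (rule Cauchy_Schwarz_ineq_sum)
    also have "(\<Sum>s<d. (\<phi> s x)\<^sup>2) = christoffel n d x"
      unfolding christoffel_def \<phi>_def by (intro sum.cong refl) (simp add: power_divide)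
    finally show ?thesis .
  qed
  have kernel_le: "christoffel n d x \<le> exp (6 * real k + 4 * \<theta> * \<bar>b x\<bar>)" if "x \<in> cube n" for x
    using christoffel_le[OF that k] by (simp add: d_def \<theta>_def b_def)
  \<comment> \<open>Where \<open>out\<close> is 1, \<theta> |b| exceeds \<theta> \<alpha> = 12 k, so
    the exponent is nonnegative.\<close>
  have out_le: "out x \<le> exp (l * (\<theta> * \<bar>b x\<bar>) - 12 * l * real k)" if "0 \<le> l" for l x
  proof (cases "\<bar>b x\<bar> \<le> \<alpha>")
    case False
    have "\<theta> * \<alpha> \<le> \<theta> * \<bar>b x\<bar>" using False \<theta>0 by (intro mult_left_mono) auto
    then have "l * (12 * real k) \<le> l * (\<theta> * \<bar>b x\<bar>)" unfolding \<theta>\<alpha> by (rule mult_left_mono) (rule that)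
    then show ?thesis using False by (simp add: out_def inn_def)
  qed (simp add: out_def inn_def)
  have mgf: "cube_avg n (\<lambda>x. exp (l * (\<theta> * \<bar>b x\<bar>))) \<le> 2 * exp (real k * l\<^sup>2 / 2)" if "0 \<le> l" for l
  proof -
    have "real n * (l * \<theta>)\<^sup>2 = (real n * \<theta>\<^sup>2) * l\<^sup>2" by (simp add: power_mult_distrib)
    then show ?thesis
      using cube_avg_exp_abs_sum_le[of "l * \<theta>" n] that \<theta>0 unfolding \<theta>2 b_def by (simp add: mult.assoc)
  qed
  have exp_k: "exp (- real k) \<le> 1 / 2"
  proof -
    have "exp (- real k) \<le> exp (- 1)" using k by simp
    also have "\<dots> \<le> 1 / 2" using exp_ge_add_one_self[of "1::real"] by (simp add: exp_minus field_simps)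
    finally show ?thesis .
  qed
  \<comment> \<open>l = 12 minimises k l^2/2 - 12 l k, with value -72 k.\<close>
  have out_avg: "cube_avg n out \<le> 2 * exp (- (72 * real k))"
  proof -
    have "cube_avg n out \<le> cube_avg n (\<lambda>x. exp (- (144 * real k)) * exp (12 * (\<theta> * \<bar>b x\<bar>)))"
      using out_le[of 12] by (intro cube_avg_mono) (simp add: algebra_simps flip: exp_add)
    also have "\<dots> \<le> exp (- (144 * real k)) * (2 * exp (real k * 12\<^sup>2 / 2))"
      unfolding cube_avg_cmult by (intro mult_left_mono mgf) auto
    also have "\<dots> = 2 * exp (- (72 * real k))" by (simp flip: exp_add)
    finally show ?thesis .
  qed
  \<comment> \<open>With l = 4 the kernel bound doubles the slope to 8, and the exponents add up to
    -48 k + 6 k + 32 k = -10 k.\<close>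
  have out_kernel: "cube_avg n (\<lambda>x. out x * christoffel n d x) \<le> 1 / 2"
  proof -
    have "cube_avg n (\<lambda>x. out x * christoffel n d x)
        \<le> cube_avg n (\<lambda>x. exp (- (42 * real k)) * exp (8 * (\<theta> * \<bar>b x\<bar>)))"
    proof (rule cube_avg_mono)
      fix x assume x: "x \<in> cube n"
      have "out x * christoffel n d x
          \<le> exp (4 * (\<theta> * \<bar>b x\<bar>) - 12 * 4 * real k) * exp (6 * real k + 4 * \<theta> * \<bar>b x\<bar>)"
        using out_le[of 4 x] kernel_le[OF x] inn_sq(4)[of x]
        by (intro mult_mono) (auto simp: christoffel_def intro!: sum_nonneg)
      then show "out x * christoffel n d x \<le> exp (- (42 * real k)) * exp (8 * (\<theta> * \<bar>b x\<bar>))"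
        by (simp add: algebra_simps flip: exp_add)
    qed
    also have "\<dots> \<le> exp (- (42 * real k)) * (2 * exp (real k * 8\<^sup>2 / 2))"
      unfolding cube_avg_cmult by (intro mult_left_mono mgf) auto
    also have "\<dots> = 2 * exp (- (10 * real k))" by (simp flip: exp_add)
    also have "\<dots> \<le> 2 * (exp (- real k)) ^ 2" by (simp flip: exp_of_nat_mult)
    also have "\<dots> \<le> 2 * (1 / 2) ^ 2" using exp_k by (intro mult_left_mono power_mono) auto
    finally show ?thesis by (simp add: power2_eq_square)
  qed

  \<comment> \<open>By the kernel bound at most half of the squared norm of \<open>P v\<close> lies
    outside, so the restricted Gram matrix has all eigenvalues at least 1/2.\<close>
  have inn_norm: "(\<Sum>s<d. (v s)\<^sup>2) / 2 \<le> cube_avg n (\<lambda>x. inn x * (P v x)\<^sup>2)" for v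
  proof -
    let ?N = "\<Sum>s<d. (v s)\<^sup>2"
    have "cube_avg n (\<lambda>x. out x * (P v x)\<^sup>2) \<le> cube_avg n (\<lambda>x. ?N * (out x * christoffel n d x))"
    proof (rule cube_avg_mono)
      fix x
      show "out x * (P v x)\<^sup>2 \<le> ?N * (out x * christoffel n d x)"
        using mult_left_mono[OF P_sq[of v x] inn_sq(4)[of x]] by (simp add: mult_ac)
    qed
    also have "\<dots> \<le> ?N * (1 / 2)"
      unfolding cube_avg_cmult using out_kernel by (intro mult_left_mono) (auto intro: sum_nonneg)
    finally have "cube_avg n (\<lambda>x. out x * (P v x)\<^sup>2) \<le> ?N / 2" by simp
    moreover have "cube_avg n (\<lambda>x. inn x * (P v x)\<^sup>2)
        = cube_avg n (\<lambda>x. P v x * P v x - out x * (P v x)\<^sup>2)"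
      by (intro cube_avg_cong) (simp add: out_def algebra_simps power2_eq_square)
    ultimately show ?thesis unfolding cube_avg_diff P_mult by (simp add: power2_eq_square)
  qed

  define G where "G s t = cube_avg n (\<lambda>x. inn x * \<phi> t x * \<phi> s x)" for s t
  have G_apply: "(\<Sum>t<d. G s t * v t) = cube_avg n (\<lambda>x. inn x * P v x * \<phi> s x)" for s v
    unfolding G_def P_def sum_distrib_left sum_distrib_right cube_avg_sum
    by (subst mult.commute, subst cube_avg_cmult[symmetric], intro sum.cong cube_avg_cong) auto
  have G_form: "cube_avg n (\<lambda>x. inn x * P v x * P w x) = (\<Sum>s<d. w s * (\<Sum>t<d. G s t * v t))" for v w
  proof -
    have "cube_avg n (\<lambda>x. inn x * P v x * P w x)
      = cube_avg n (\<lambda>x. \<Sum>s<d. w s * (inn x * P v x * \<phi> s x))"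
      unfolding P_def[of w] sum_distrib_left by (intro cube_avg_cong sum.cong) (auto simp: mult_ac)
    then show ?thesis unfolding cube_avg_sum cube_avg_cmult G_apply .
  qed
  have "\<forall>t<d. v t = 0" if v: "\<And>s. s < d \<Longrightarrow> (\<Sum>t<d. G s t * v t) = 0" for v
  proof -
    have "cube_avg n (\<lambda>x. inn x * (P v x)\<^sup>2) = 0"
      using G_form[of v v] v by (simp add: power2_eq_square mult.assoc)
    then have "(\<Sum>s<d. (v s)\<^sup>2) \<le> 0" using inn_norm[of v] by simp
    moreover have "0 \<le> (\<Sum>s<d. (v s)\<^sup>2)" by (intro sum_nonneg) auto
    ultimately have "(\<Sum>s<d. (v s)\<^sup>2) = 0" by simp
    then show ?thesis by (subst (asm) sum_nonneg_eq_0_iff) auto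
  qed
  then obtain u where u: "\<And>s. s < d \<Longrightarrow> (\<Sum>t<d. G s t * u t) = c s"
    using nonsingular_system_solvable[of d G c] by blast

  \<comment> \<open>\<open>P v\<close> = \<open>P u\<close> - 1 is the correction to the constant
    density.\<close>
  define v where "v s = u s - c s" for s
  define N where "N = (\<Sum>s<d. (v s)\<^sup>2)"
  have N0: "0 \<le> N" unfolding N_def by (intro sum_nonneg) auto
  have d0: "0 < d" using k by (simp add: d_def)
  have c_sum: "(\<Sum>s<d. c s * w s) = w 0" for w
    using d0 by (simp add: c_def if_distrib[of "\<lambda>z. z * _"] sum.delta cong: if_cong)
  have Pc: "P c x = 1" for x
    unfolding P_def using c_sum[of "\<lambda>s. \<phi> s x"] by (simp add: \<phi>_def esym_0)
  have Pv: "P v x = P u x - 1" for x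
    unfolding Pc[of x, symmetric] by (simp add: P_def v_def sum_subtractf left_diff_distrib)
  \<comment> \<open>Testing the system against \<open>v\<close> gives E[inn (P v)^2] = E[out P v].
    The left side is at least N/2, the right side at most sqrt (N E[out]) by
    Cauchy--Schwarz.\<close>
  have N_le: "N \<le> 4 * cube_avg n out"
  proof -
    have "cube_avg n (\<lambda>x. inn x * (P v x)\<^sup>2) = cube_avg n (\<lambda>x. out x * P v x)"
    proof -
      have "cube_avg n (\<lambda>x. inn x * P u x * P v x) = v 0"
        unfolding G_form by (simp add: u mult.commute[of "v _"] c_sum)
      moreover have "cube_avg n (\<lambda>x. P c x * P v x) = v 0" unfolding P_mult by (rule c_sum)
      moreover have "cube_avg n (\<lambda>x. inn x * (P v x)\<^sup>2)
        = cube_avg n (\<lambda>x. out x * P v x + (inn x * P u x * P v x - P c x * P v x))"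
        by (intro cube_avg_cong) (simp add: out_def Pv Pc algebra_simps power2_eq_square)
      ultimately show ?thesis unfolding cube_avg_add cube_avg_diff by simp
    qed
    then have "N / 2 \<le> cube_avg n (\<lambda>x. out x * P v x)" using inn_norm[of v] by (simp add: N_def)
    then have "(N / 2)\<^sup>2 \<le> (cube_avg n (\<lambda>x. out x * P v x))\<^sup>2" using N0 by (intro power_mono) auto
    also have "\<dots> \<le> cube_avg n (\<lambda>x. (out x)\<^sup>2) * cube_avg n (\<lambda>x. (P v x)\<^sup>2)"
      by (rule cube_avg_Cauchy_Schwarz)
    also have "\<dots> = cube_avg n out * N"
      using P_mult[of v v] by (simp add: N_def power2_eq_square inn_sq)
    finally have "N * N \<le> N * (4 * cube_avg n out)" by (simp add: power2_eq_square mult_ac)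
    then show ?thesis
    proof (cases "N = 0")
      case True
      then show ?thesis using inn_sq(4) by (auto intro!: mult_nonneg_nonneg cube_avg_nonneg)
    next
      case False
      then show ?thesis using N0 \<open>N * N \<le> N * (4 * cube_avg n out)\<close> by simp
    qed
  qed
  \<comment> \<open>The exponents -72 k from \<open>N\<close> and 6 k + 48 k from the kernel leave
    -18 k, which absorbs the factor 8.\<close>
  have Pv_small: "\<bar>P v x\<bar> \<le> 1" if x: "x \<in> cube n" "\<bar>b x\<bar> \<le> \<alpha>" for x
  proof -
    have "(P v x)\<^sup>2 \<le> N * christoffel n d x" unfolding N_def by (rule P_sq)
    also have "\<dots> \<le> (4 * (2 * exp (- (72 * real k)))) * exp (6 * real k + 4 * (12 * real k))"
    proof (intro mult_mono)
      show "N \<le> 4 * (2 * exp (- (72 * real k)))" using N_le out_avg by linarith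
      have "\<theta> * \<bar>b x\<bar> \<le> \<theta> * \<alpha>" using x \<theta>0 by (intro mult_left_mono) auto
      then have "exp (6 * real k + 4 * \<theta> * \<bar>b x\<bar>) \<le> exp (6 * real k + 4 * (12 * real k))"
        unfolding \<theta>\<alpha> by simp
      then show "christoffel n d x \<le> exp (6 * real k + 4 * (12 * real k))"
        using kernel_le[OF x(1)] by linarith
    qed (auto simp: christoffel_def intro!: sum_nonneg)
    also have "\<dots> = 8 * exp (- (18 * real k))" by (simp flip: exp_add)
    also have "\<dots> \<le> 8 * (exp (- real k)) ^ 3" by (simp flip: exp_of_nat_mult)
    also have "\<dots> \<le> 8 * (1 / 2) ^ 3" using exp_k by (intro mult_left_mono power_mono) auto
    finally show ?thesis by (simp add: power3_eq_cube abs_square_le_1)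
  qed

  define f where "f x = inn x * P u x" for x
  have f_bounds: "0 \<le> f x" "f x \<le> 2" if "x \<in> cube n" for x
    using Pv_small[OF that] by (auto simp: f_def inn_def Pv)
  have f_\<phi>: "cube_avg n (\<lambda>x. f x * \<phi> s x) = c s" if "s < d" for s
    using u[OF that] unfolding G_apply f_def .
  have f_sym: "f x = f y" if "x \<in> cube n" "y \<in> cube n" "(\<Sum>i=1..n. x i) = (\<Sum>i=1..n. y i)" for x y
    using that esym_eq_if_sum_eq[OF that] by (simp add: f_def inn_def b_def P_def \<phi>_def)
  have coeff: "cube_avg n (\<lambda>x. f x * esym n (card S) x)
      = real (n choose card S) * cube_avg n (\<lambda>x. f x * prod x S)" if "S \<subseteq> {1..n}" for S
    by (rule symmetric_Fourier_coefficient[OF _ that]) (rule f_sym)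
  have le_n: "card S \<le> n" if "S \<subseteq> {1..n}" for S
    using card_mono[OF _ that] by simp
  show ?thesis
  proof (rule that[of f])
    show "0 \<le> f x" if "x \<in> cube n" for x using f_bounds that by blast
    show "f x = 0" if "12 * sqrt (real n * real k) < \<bar>\<Sum>i=1..n. x i\<bar>" for x
      using that by (simp add: f_def inn_def \<alpha>_def b_def)
    show "cube_avg n f = 1"
      using f_\<phi>[OF d0] by (simp add: \<phi>_def esym_0 c_def)
    show "cube_avg n (\<lambda>x. f x * prod x S) = 0" if S: "S \<subseteq> {1..n}" "S \<noteq> {}" "card S < 2 * k" for S
    proof -
      have "card S \<noteq> 0" using S finite_subset by fastforce
      then have "cube_avg n (\<lambda>x. f x * \<phi> (card S) x) = 0"
        using f_\<phi>[of "card S"] S by (simp add: d_def c_def)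
      moreover have "cube_avg n (\<lambda>x. f x * \<phi> (card S) x)
        = cube_avg n (\<lambda>x. (1 / sqrt (real (n choose card S))) * (f x * esym n (card S) x))"
        by (intro cube_avg_cong) (simp add: \<phi>_def)
      ultimately show ?thesis
        unfolding cube_avg_cmult coeff[OF S(1)] using le_n[OF S(1)] by simp
    qed
    show "(cube_avg n (\<lambda>x. f x * prod x S))\<^sup>2 * real (n choose card S) \<le> 4" if S: "S \<subseteq> {1..n}" for S
    proof -
      let ?C = "real (n choose card S)" and ?a = "cube_avg n (\<lambda>x. f x * prod x S)"
      have C: "0 < ?C" using le_n[OF S] by simp
      \<comment> \<open>Bessel's inequality at one level: the squared norm of \<open>esym\<close> is
        the same binomial coefficient, so one factor \<open>?C\<close> cancels.\<close>
      have "(?C * ?a)\<^sup>2 \<le> cube_avg n (\<lambda>x. (f x)\<^sup>2) * cube_avg n (\<lambda>x. (esym n (card S) x)\<^sup>2)"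
        unfolding coeff[OF S, symmetric] by (rule cube_avg_Cauchy_Schwarz)
      also have "cube_avg n (\<lambda>x. (esym n (card S) x)\<^sup>2) = ?C"
        using cube_avg_esym_mult[of n "card S" "card S"] by (simp add: power2_eq_square)
      also have "cube_avg n (\<lambda>x. (f x)\<^sup>2) * ?C \<le> cube_avg n (\<lambda>_. 4) * ?C"
      proof (intro mult_right_mono cube_avg_mono)
        fix x assume "x \<in> cube n"
        then have "(f x)\<^sup>2 \<le> 2\<^sup>2" using f_bounds by (intro power_mono) auto
        then show "(f x)\<^sup>2 \<le> 4" by simp
      qed simp
      finally have "?C * (?a\<^sup>2 * ?C) \<le> ?C * 4"
        by (simp add: cube_avg_const power2_eq_square mult_ac)
      then show ?thesis using C by simp
    qed
  qed
qed

section \<open>Noise\<close>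

lemma sum_cube_Suc:
  "(\<Sum>z\<in>cube (Suc n). g z) = (\<Sum>z\<in>cube n. g (z(Suc n := 1)) + g (z(Suc n := -1)))"
proof -
  have inj: "inj_on (\<lambda>(v, z). z(Suc n := v)) ({-1, 1} \<times> cube n)"
    unfolding cube_def by (rule inj_combinator) simp
  have "cube (Suc n) = (\<lambda>(v, z). z(Suc n := v)) ` ({-1, 1} \<times> cube n)"
  proof -
    have "{1..Suc n} = insert (Suc n) {1..n}" by auto
    then show ?thesis unfolding cube_def by (simp only: PiE_insert_eq)
  qed
  then have "(\<Sum>z\<in>cube (Suc n). g z) = (\<Sum>p\<in>{-1, 1} \<times> cube n. g ((\<lambda>(v, z). z(Suc n := v)) p))"
    by (simp only: sum.reindex[OF inj] o_def)
  also have "\<dots> = (\<Sum>v\<in>{-1, 1}. \<Sum>z\<in>cube n. g (z(Suc n := v)))"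
    by (subst sum.cartesian_product) (simp add: case_prod_unfold)
  finally show ?thesis by (simp add: sum.distrib add.commute)
qed

text \<open>The point masses of independent signs of mean r; r = 0 gives the uniform
  distribution.\<close>

definition noise_weight :: "real \<Rightarrow> nat \<Rightarrow> (nat \<Rightarrow> real) \<Rightarrow> real" where
  "noise_weight r n z = (\<Prod>i=1..n. (1 + r * z i) / 2)"

text \<open>For x in the cube, the tail of the sum of x multiplied by noise of parameter r: a
  coordinate 1 becomes a sign of mean r, a coordinate -1 one of mean -r.\<close>

definition signed_tail :: "real \<Rightarrow> nat \<Rightarrow> (nat \<Rightarrow> real) \<Rightarrow> real \<Rightarrow> real" where
  "signed_tail r n x = tail r (card {i \<in> {1..n}. x i = 1}) (card {i \<in> {1..n}. x i \<noteq> 1})"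

lemma noise_weight_Suc: "noise_weight r (Suc n) (z(Suc n := v)) = noise_weight r n z * ((1 + r * v) / 2)"
  unfolding noise_weight_def by (simp add: prod.nat_ivl_Suc')

lemma signed_tail_cong:
  assumes "\<And>i. i \<in> {1..n} \<Longrightarrow> x i = y i" shows "signed_tail r n x = signed_tail r n y"
proof -
  have "{i \<in> {1..n}. x i = 1} = {i \<in> {1..n}. y i = 1}" "{i \<in> {1..n}. x i \<noteq> 1} = {i \<in> {1..n}. y i \<noteq> 1}"
    using assms by auto
  then show ?thesis by (simp only: signed_tail_def)
qed

lemma signed_tail_Suc:
  assumes "x (Suc n) = -1 \<or> x (Suc n) = 1"
  shows "signed_tail r (Suc n) x s = (1 + r * x (Suc n)) / 2 * signed_tail r n x (s - 1)
    + (1 - r * x (Suc n)) / 2 * signed_tail r n x (s + 1)"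
proof -
  have split: "{i \<in> {1..Suc n}. P i} = (if P (Suc n) then insert (Suc n) {i \<in> {1..n}. P i} else {i \<in> {1..n}. P i})"
    for P by (auto simp: le_Suc_eq)
  show ?thesis
    using assms unfolding signed_tail_def split by (auto simp: tail_Suc_right)
qed

lemma signed_tail_one:
  assumes "\<And>i. i \<in> {1..n} \<Longrightarrow> x i = -1 \<or> x i = 1"
  shows "signed_tail 1 n x s = (if s \<le> (\<Sum>i=1..n. x i) then 1 else 0)"
  using assms
proof (induction n arbitrary: s)
  case 0
  then show ?case by (simp add: signed_tail_def)
next
  case (Suc n)
  have v: "x (Suc n) = -1 \<or> x (Suc n) = 1" using Suc.prems by simp
  have "signed_tail 1 n x s = (if s \<le> (\<Sum>i=1..n. x i) then 1 else 0)" for s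
    using Suc.IH Suc.prems by simp
  then show ?case unfolding signed_tail_Suc[of x n, OF v] using v by auto
qed

text \<open>Multiplying by independent noise multiplies the mean of every coordinate, so tails of
  noisy sums compose.\<close>

lemma sum_noise_weight_signed_tail:
  assumes "\<And>i. i \<in> {1..n} \<Longrightarrow> y i = -1 \<or> y i = 1"
  shows "(\<Sum>z\<in>cube n. noise_weight r n z * signed_tail q n (\<lambda>i. y i * z i) s)
    = signed_tail (r * q) n y s"
  using assms
proof (induction n arbitrary: s)
  case 0
  then show ?case by (simp add: cube_def noise_weight_def signed_tail_def)
next
  case (Suc n)
  let ?T = "\<lambda>z s. signed_tail q n (\<lambda>i. y i * z i) s" and ?v = "y (Suc n)"
  have v: "?v = -1 \<or> ?v = 1" using Suc.prems by simp
  have IH: "(\<Sum>z\<in>cube n. noise_weight r n z * ?T z s) = signed_tail (r * q) n y s" for s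
    using Suc.IH Suc.prems by simp
  have step: "signed_tail q (Suc n) (\<lambda>i. y i * (z(Suc n := w)) i) s
      = (1 + q * (?v * w)) / 2 * ?T z (s - 1) + (1 - q * (?v * w)) / 2 * ?T z (s + 1)"
    if "w = -1 \<or> w = 1" for z w
  proof -
    have "signed_tail q n (\<lambda>i. y i * (z(Suc n := w)) i) = signed_tail q n (\<lambda>i. y i * z i)"
      by (rule signed_tail_cong) simp
    then show ?thesis
      using signed_tail_Suc[of "\<lambda>i. y i * (z(Suc n := w)) i" n q s] v that by auto
  qed
  have "(\<Sum>z\<in>cube (Suc n). noise_weight r (Suc n) z * signed_tail q (Suc n) (\<lambda>i. y i * z i) s)
    = (\<Sum>z\<in>cube n. (1 + r * q * ?v) / 2 * (noise_weight r n z * ?T z (s - 1))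
        + (1 - r * q * ?v) / 2 * (noise_weight r n z * ?T z (s + 1)))"
    unfolding sum_cube_Suc noise_weight_Suc by (intro sum.cong refl) (simp only: step simp_thms, simp add: field_simps)
  also have "\<dots> = signed_tail (r * q) (Suc n) y s"
    unfolding sum.distrib sum_distrib_left[symmetric] IH signed_tail_Suc[of y, OF v] ..
  finally show ?case .
qed

lemma noise_weight_0: "noise_weight 0 n z = 1 / 2 ^ n"
  by (simp add: noise_weight_def power_one_over)

lemma sum_noise_weight_prod:
  assumes "S \<subseteq> {1..n}"
  shows "(\<Sum>z\<in>cube n. noise_weight r n z * prod z S) = r ^ card S"
proof -
  have "(\<Sum>z\<in>cube n. noise_weight r n z * prod z S)
    = (\<Sum>z\<in>cube n. \<Prod>i=1..n. (1 + r * z i) / 2 * (if i \<in> S then z i else 1))"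
    using assms unfolding noise_weight_def prod.distrib by (simp add: prod.If_cases Int_absorb1)
  also have "\<dots> = (\<Prod>i=1..n. \<Sum>v\<in>{-1, 1}. (1 + r * v) / 2 * (if i \<in> S then v else 1))"
    unfolding cube_def by (rule prod_sum_PiE[symmetric]) auto
  also have "\<dots> = (\<Prod>i=1..n. if i \<in> S then r else 1)"
    by (intro prod.cong refl) (simp add: field_simps)
  also have "\<dots> = r ^ card S"
    using assms by (simp add: prod.If_cases Int_absorb1)
  finally show ?thesis .
qed

section \<open>The noise distribution and its action on tails\<close>

lemma pmf_noise_bit:
  assumes "0 \<le> r" "r \<le> 1"
  shows "pmf (noise_bit r) v = (if v = -1 \<or> v = 1 then (1 + r * v) / 2 else 0)"
  using assms by (auto simp: noise_bit_def pmf_bind field_simps)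

lemma noise_support:
  assumes "0 \<le> r" "r \<le> 1" shows "set_pmf (noise n r) \<subseteq> cube n"
proof -
  have *: "v = -1 \<or> v = 1" if "v \<in> set_pmf (noise_bit r)" for v
    using that pmf_noise_bit[OF assms, of v] by (auto simp: set_pmf_iff split: if_splits)
  have "set_pmf (noise n r) \<subseteq> PiE_dflt {1..n} undefined (\<lambda>_. set_pmf (noise_bit r))"
    unfolding noise_def by (simp add: set_Pi_pmf comp_def)
  then have "(i \<in> {1..n} \<longrightarrow> x i \<in> set_pmf (noise_bit r)) \<and> (i \<notin> {1..n} \<longrightarrow> x i = undefined)"
    if "x \<in> set_pmf (noise n r)" for x i
    using that unfolding PiE_dflt_def by blast
  then show ?thesis using * unfolding cube_def PiE_def Pi_def extensional_def by blast
qed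

lemma pmf_noise:
  assumes "0 \<le> r" "r \<le> 1" "z \<in> cube n" shows "pmf (noise n r) z = noise_weight r n z"
proof -
  have "pmf (noise n r) z = (\<Prod>i=1..n. pmf (noise_bit r) (z i))"
    unfolding noise_def using assms(3) by (intro pmf_Pi') (auto simp: cube_def PiE_def extensional_def)
  also have "\<dots> = noise_weight r n z"
    unfolding noise_weight_def using cubeD[OF assms(3)] assms(1,2)
    by (intro prod.cong refl) (auto simp: pmf_noise_bit)
  finally show ?thesis .
qed

lemma expectation_coord_product:
  fixes g :: "(nat \<Rightarrow> real) \<Rightarrow> real"
  assumes D: "set_pmf D \<subseteq> cube n" and r: "0 \<le> r" "r \<le> 1"
  shows "measure_pmf.expectation (coord_product n D (noise n r)) g
    = (\<Sum>x\<in>cube n. pmf D x * (\<Sum>z\<in>cube n. noise_weight r n z * g (\<lambda>i\<in>{1..n}. x i * z i)))"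
proof -
  let ?h = "\<lambda>x z. g (\<lambda>i\<in>{1..n}. x i * z i)"
  have "measure_pmf.expectation (coord_product n D (noise n r)) g
    = measure_pmf.expectation (pair_pmf D (noise n r)) (\<lambda>p. ?h (fst p) (snd p))"
    unfolding coord_product_def integral_map_pmf by (simp add: case_prod_unfold)
  also have "\<dots> = (\<Sum>p\<in>cube n \<times> cube n. ?h (fst p) (snd p) * pmf (pair_pmf D (noise n r)) p)"
    using D noise_support[OF r, of n] by (intro integral_measure_pmf_real) (auto simp: set_pair_pmf)
  also have "\<dots> = (\<Sum>x\<in>cube n. \<Sum>z\<in>cube n. ?h x z * (pmf D x * pmf (noise n r) z))"
    unfolding sum.cartesian_product by (intro sum.cong) (auto simp: pmf_pair)
  also have "\<dots> = (\<Sum>x\<in>cube n. pmf D x * (\<Sum>z\<in>cube n. noise_weight r n z * ?h x z))"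
    unfolding sum_distrib_left by (intro sum.cong refl) (simp add: pmf_noise[OF r] mult_ac)
  finally show ?thesis .
qed

lemma coord_product_support:
  assumes D: "set_pmf D \<subseteq> cube n" and r: "0 \<le> r" "r \<le> 1"
  shows "set_pmf (coord_product n D (noise n r)) \<subseteq> cube n"
proof -
  have "(\<lambda>i\<in>{1..n}. x i * z i) \<in> cube n" if "x \<in> cube n" "z \<in> cube n" for x z
    using cubeD[OF that(1)] cubeD[OF that(2)] unfolding cube_def by (intro restrict_PiE[THEN iffD2]) fastforce
  then show ?thesis
    using D noise_support[OF r, of n] by (auto simp: coord_product_def set_pair_pmf)
qed

text \<open>A round of noise is absorbed into the parameter of the tail. Two uses merge the noise
  \<rho> and the extra round 1/2 into \<rho>/2.\<close>

lemma expectation_signed_tail_coord_product: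
  assumes D: "set_pmf D \<subseteq> cube n" and r: "0 \<le> r" "r \<le> 1"
  shows "measure_pmf.expectation (coord_product n D (noise n r)) (\<lambda>x. signed_tail q n x t)
    = measure_pmf.expectation D (\<lambda>x. signed_tail (r * q) n x t)"
proof -
  have "(\<Sum>z\<in>cube n. noise_weight r n z * signed_tail q n (\<lambda>i\<in>{1..n}. x i * z i) t)
    = signed_tail (r * q) n x t" if "x \<in> cube n" for x
  proof -
    have "signed_tail q n (\<lambda>i\<in>{1..n}. x i * z i) = signed_tail q n (\<lambda>i. x i * z i)" for z
      by (rule signed_tail_cong) simp
    then show ?thesis using sum_noise_weight_signed_tail[of n x r q t] cubeD[OF that] by simp
  qed
  then have "measure_pmf.expectation (coord_product n D (noise n r)) (\<lambda>x. signed_tail q n x t)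
    = (\<Sum>x\<in>cube n. signed_tail (r * q) n x t * pmf D x)"
    unfolding expectation_coord_product[OF D r] by (intro sum.cong refl) simp
  also have "\<dots> = measure_pmf.expectation D (\<lambda>x. signed_tail (r * q) n x t)"
    using D by (intro integral_measure_pmf_real[symmetric]) auto
  finally show ?thesis .
qed

lemma prob_coord_sum_ge:
  assumes D: "set_pmf D \<subseteq> cube n"
  shows "measure_pmf.prob D {x. t \<le> coord_sum n x} = measure_pmf.expectation D (\<lambda>x. signed_tail 1 n x t)"
proof -
  have "measure_pmf.prob D {x. t \<le> coord_sum n x} = measure_pmf.expectation D (indicator {x. t \<le> coord_sum n x})"
    by simp
  also have "\<dots> = measure_pmf.expectation D (\<lambda>x. signed_tail 1 n x t)"
  proof (rule integral_cong_AE)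
    show "AE x in measure_pmf D. indicator {x. t \<le> coord_sum n x} x = signed_tail 1 n x t"
      unfolding AE_measure_pmf_iff
    proof
      fix x assume "x \<in> set_pmf D"
      then have "x \<in> cube n" using D by blast
      then show "indicator {x. t \<le> coord_sum n x} x = signed_tail 1 n x t"
        using signed_tail_one[of n x t] cubeD by (simp add: coord_sum_def indicator_def)
    qed
  qed auto
  finally show ?thesis .
qed

text \<open>Noise leaves the uniform distribution unchanged, so \<open>r\<close> is arbitrary:
  uniform is noise of parameter 0 around the all-ones point, and composing with parameter
  \<open>q\<close> gives \<open>0 * q\<close>.\<close>

lemma prob_uniform_cube_coord_sum_ge:
  "measure_pmf.prob (uniform_cube n) {x. t \<le> coord_sum n x} = cube_avg n (\<lambda>x. signed_tail r n x t)"
proof -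
  have avg: "cube_avg n (\<lambda>x. signed_tail q n x t) = signed_tail 0 n (\<lambda>_. 1) t" for q
    using sum_noise_weight_signed_tail[of n "\<lambda>_. 1" 0 q t]
    by (simp add: cube_avg_def noise_weight_0 sum_divide_distrib)
  have ne: "cube n \<noteq> {}" using card_cube[of n] by auto
  have sp: "set_pmf (uniform_cube n) \<subseteq> cube n" by (simp add: uniform_cube_def set_pmf_of_set ne)
  have "measure_pmf.prob (uniform_cube n) {x. t \<le> coord_sum n x} = cube_avg n (\<lambda>x. signed_tail 1 n x t)"
    unfolding prob_coord_sum_ge[OF sp] unfolding uniform_cube_def
    by (simp add: integral_pmf_of_set ne cube_avg_def card_cube)
  then show ?thesis by (simp add: avg)
qed

section \<open>A lower bound for the tail of the uniform sum\<close>

lemma one_plus_half_square_le_cosh: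
  fixes x :: real assumes "0 \<le> x" shows "1 + x\<^sup>2 / 2 \<le> cosh x"
proof -
  have "(\<lambda>x. sinh x - x) 0 \<le> (\<lambda>x. sinh x - x) (x / 2)"
  proof (rule DERIV_nonneg_imp_nondecreasing[where f = "\<lambda>x. sinh x - x"])
    show "\<exists>d. ((\<lambda>x. sinh x - x) has_real_derivative d) (at y) \<and> 0 \<le> d" for y :: real
      using cosh_real_ge_1[of y]
      by (intro exI[of _ "cosh y - 1"] conjI) (auto intro!: derivative_eq_intros)
  qed (use assms in simp)
  then have "(x / 2)\<^sup>2 \<le> (sinh (x / 2))\<^sup>2" using assms by (intro power_mono) auto
  moreover have "cosh x = 1 + 2 * (sinh (x / 2))\<^sup>2"
    using cosh_double[of "x / 2"] cosh_square_eq[of "x / 2"] by simp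
  ultimately show ?thesis by (simp add: power_divide)
qed

text \<open>The square root of C = cosh (2 l) is at most exp (l^2) by the sub-Gaussian bound, and at
  most (1 + C)/2 = cosh^2 l by the arithmetic-geometric mean. The product of the two bounds controls
  the second moment of exp (l b) by the squared first moment.\<close>

lemma cosh_double_le: "cosh (2 * l) \<le> exp (l\<^sup>2) * (cosh l)\<^sup>2" for l :: real
proof -
  define C where "C = cosh (2 * l)"
  have C: "1 \<le> C" using cosh_real_ge_1[of "2 * l"] by (simp add: C_def)
  have "C \<le> (exp (l\<^sup>2))\<^sup>2"
    using cosh_le_exp_square[of "2 * l"] by (simp add: C_def power_mult_distrib flip: exp_of_nat_mult)
  then have 1: "sqrt C \<le> exp (l\<^sup>2)" by (rule real_le_lsqrt[rotated]) auto
  have 2: "sqrt C \<le> (cosh l)\<^sup>2"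
  proof -
    have "(cosh l)\<^sup>2 = (1 + C) / 2"
      using cosh_double[of l] cosh_square_eq[of l] by (simp add: C_def)
    moreover have "0 \<le> (sqrt C - 1)\<^sup>2" by simp
    ultimately show ?thesis using C by (simp add: power2_diff)
  qed
  have "C = sqrt C * sqrt C" using C by simp
  also have "\<dots> \<le> exp (l\<^sup>2) * (cosh l)\<^sup>2" using 1 2 C by (intro mult_mono) auto
  finally show ?thesis by (simp add: C_def)
qed

text \<open>A lower bound for the upper tail of the uniform sum, by the Paley--Zygmund inequality for
  the exponential of the sum.\<close>

lemma cube_avg_tail_ge:
  assumes s: "0 < s" "s \<le> real n / 8" "real n \<le> 8 * s\<^sup>2"
  shows "exp (- (64 * s\<^sup>2 / real n)) / 4 \<le> cube_avg n (\<lambda>x. if s \<le> (\<Sum>i=1..n. x i) then 1 else 0)"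
proof -
  \<comment> \<open>Then l s = n l^2/8, so the mean \<open>\<mu>\<close> >= exp (n l^2/4) is at
    least twice exp (l s), because n l^2 >= 8. The loss in the second moment is exp (n l^2) = exp
    (64 s^2/n).\<close>
  define l where "l = 8 * s / real n"
  define X where "X x = exp (l * (\<Sum>i=1..n. x i))" for x :: "nat \<Rightarrow> real"
  define I where "I x = (if s \<le> (\<Sum>i=1..n. x i) then 1 else 0 :: real)" for x :: "nat \<Rightarrow> real"
  define \<mu> where "\<mu> = cosh l ^ n"
  have n: "0 < real n" using s by simp
  have l: "0 \<le> l" "l \<le> 1" using s n by (simp_all add: l_def)
  have \<mu>0: "0 < \<mu>" by (simp add: \<mu>_def)
  have nl: "real n * l\<^sup>2 = 64 * s\<^sup>2 / real n" "l * s = real n * l\<^sup>2 / 8"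
    using n by (simp_all add: l_def power_divide power2_eq_square)
  have large: "8 \<le> real n * l\<^sup>2" using s n by (simp add: nl field_simps)
  have \<mu>_ge: "2 * exp (l * s) \<le> \<mu>"
  proof -
    have l2: "l\<^sup>2 \<le> 1" using l by (simp add: power_le_one)
    have "exp (l\<^sup>2 / 4) \<le> 1 + l\<^sup>2 / 4 + (l\<^sup>2 / 4)\<^sup>2" using l2 by (intro exp_bound) auto
    also have "\<dots> \<le> 1 + l\<^sup>2 / 2"
    proof -
      have "(l\<^sup>2)\<^sup>2 \<le> l\<^sup>2" unfolding power2_eq_square[of "l\<^sup>2"] by (rule mult_left_le[OF l2]) simp
      moreover have "(l\<^sup>2 / 4)\<^sup>2 = (l\<^sup>2)\<^sup>2 / 16" by (simp add: power_divide)
      moreover have "0 \<le> l\<^sup>2" by simp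
      ultimately show ?thesis by linarith
    qed
    also have "\<dots> \<le> cosh l" by (rule one_plus_half_square_le_cosh) (rule l)
    finally have "exp (l\<^sup>2 / 4) ^ n \<le> \<mu>" unfolding \<mu>_def by (intro power_mono) auto
    moreover have "2 * exp (l * s) \<le> exp (l\<^sup>2 / 4) ^ n"
    proof -
      have "2 \<le> exp (real n * l\<^sup>2 / 8)"
        using large exp_ge_add_one_self[of "real n * l\<^sup>2 / 8"] by linarith
      then have "2 * exp (l * s) \<le> exp (real n * l\<^sup>2 / 8) * exp (l * s)" by (intro mult_right_mono) auto
      also have "\<dots> = exp (l\<^sup>2 / 4) ^ n" unfolding nl(2) by (simp add: algebra_simps flip: exp_add exp_of_nat_mult)
      finally show ?thesis .
    qed
    ultimately show ?thesis by linarith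
  qed
  have "\<mu> = cube_avg n X" unfolding X_def \<mu>_def cube_avg_exp_sum ..
  \<comment> \<open>Off the event \<open>X\<close> is at most exp (l s) <= \<mu>/2, so the event
    carries at least half of the mean.\<close>
  also have "\<dots> \<le> cube_avg n (\<lambda>x. \<mu> / 2 + X x * I x)"
  proof (rule cube_avg_mono)
    fix x
    show "X x \<le> \<mu> / 2 + X x * I x"
    proof (cases "s \<le> (\<Sum>i=1..n. x i)")
      case False
      then have "X x \<le> exp (l * s)" unfolding X_def using l by (auto intro: mult_left_mono)
      then show ?thesis using False \<mu>_ge by (simp add: I_def)
    qed (use \<mu>0 in \<open>simp add: I_def\<close>)
  qed
  finally have "\<mu> / 2 \<le> cube_avg n (\<lambda>x. X x * I x)" by (simp add: cube_avg_add cube_avg_const)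
  then have "(\<mu> / 2)\<^sup>2 \<le> (cube_avg n (\<lambda>x. X x * I x))\<^sup>2" using \<mu>0 by (intro power_mono) auto
  also have "\<dots> \<le> cube_avg n (\<lambda>x. (X x)\<^sup>2) * cube_avg n (\<lambda>x. (I x)\<^sup>2)"
    by (rule cube_avg_Cauchy_Schwarz)
  also have "cube_avg n (\<lambda>x. (X x)\<^sup>2) = cosh (2 * l) ^ n"
    unfolding cube_avg_exp_sum[symmetric] X_def by (simp add: mult.assoc flip: exp_of_nat_mult)
  also have "cube_avg n (\<lambda>x. (I x)\<^sup>2) = cube_avg n I" by (intro cube_avg_cong) (simp add: I_def)
  also have "cosh (2 * l) ^ n * cube_avg n I \<le> (exp (l\<^sup>2) * (cosh l)\<^sup>2) ^ n * cube_avg n I"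
    by (intro mult_right_mono power_mono cosh_double_le cube_avg_nonneg) (auto simp: I_def)
  also have "\<dots> = \<mu>\<^sup>2 * (exp (real n * l\<^sup>2) * cube_avg n I)"
    by (simp add: \<mu>_def power_mult_distrib exp_of_nat_mult mult_ac flip: power_mult)
  finally have "\<mu>\<^sup>2 * (1 / 4) \<le> \<mu>\<^sup>2 * (exp (real n * l\<^sup>2) * cube_avg n I)"
    by (simp add: power_divide)
  then have "1 / 4 \<le> exp (real n * l\<^sup>2) * cube_avg n I" using \<mu>0 by simp
  then show ?thesis by (simp add: nl(1) I_def[abs_def] exp_minus field_simps)
qed

lemma pmf_with_density:
  assumes f0: "\<And>x. x \<in> cube n \<Longrightarrow> 0 \<le> f x" and f1: "cube_avg n f = 1"
  obtains D where "set_pmf D \<subseteq> cube n" "\<And>x. x \<in> cube n \<Longrightarrow> pmf D x = f x / 2 ^ n"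
proof -
  define g where "g x = (if x \<in> cube n then f x / 2 ^ n else 0)" for x
  have g0: "0 \<le> g x" for x using f0 by (simp add: g_def)
  have "(\<integral>\<^sup>+x. ennreal (g x) \<partial>count_space UNIV) = (\<Sum>x\<in>cube n. ennreal (g x))"
    by (rule nn_integral_count_space') (auto simp: g_def)
  also have "\<dots> = ennreal (\<Sum>x\<in>cube n. g x)" using g0 by (intro sum_ennreal) auto
  also have "(\<Sum>x\<in>cube n. g x) = 1" using f1 by (simp add: g_def cube_avg_def sum_divide_distrib)
  finally have g1: "(\<integral>\<^sup>+x. ennreal (g x) \<partial>count_space UNIV) = 1" by simp
  show ?thesis
  proof (rule that[of "embed_pmf g"])
    show "set_pmf (embed_pmf g) \<subseteq> cube n" unfolding set_embed_pmf[OF g0 g1] by (auto simp: g_def)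
    show "pmf (embed_pmf g) x = f x / 2 ^ n" if "x \<in> cube n" for x
      using that by (simp add: pmf_embed_pmf[OF g0 g1] g_def)
  qed
qed

section \<open>The separation\<close>

text \<open>With \<open>a\<close> the number of coordinates equal to 1, the noisy tail of a point
  depends only on its coordinate sum.\<close>

lemma signed_tail_cube:
  assumes x: "x \<in> cube n"
  obtains a where "a \<le> n" "(\<Sum>i=1..n. x i) = 2 * real a - real n" "signed_tail r n x = tail r a (n - a)"
proof -
  let ?A = "{i \<in> {1..n}. x i = 1}" and ?B = "{i \<in> {1..n}. x i \<noteq> 1}"
  have Un: "?A \<union> ?B = {1..n}" by auto
  have "card (?A \<union> ?B) = card ?A + card ?B" by (rule card_Un_disjoint) auto
  then have card: "card ?A + card ?B = n" by (simp only: Un card_atLeastAtMost)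
  have "sum x (?A \<union> ?B) = sum x ?A + sum x ?B" by (rule sum.union_disjoint) auto
  then have "(\<Sum>i=1..n. x i) = (\<Sum>i\<in>?A. x i) + (\<Sum>i\<in>?B. x i)" by (simp only: Un)
  also have "(\<Sum>i\<in>?A. x i) = (\<Sum>i\<in>?A. 1)" by (intro sum.cong) auto
  also have "(\<Sum>i\<in>?B. x i) = (\<Sum>i\<in>?B. -1)" using cubeD[OF x] by (intro sum.cong) auto
  finally have "(\<Sum>i=1..n. x i) = real (card ?A) - real (card ?B)" by simp
  moreover have "card ?B = n - card ?A" "card ?A \<le> n" using card by linarith+
  ultimately show ?thesis by (intro that[of "card ?A"]) (simp_all add: signed_tail_def of_nat_diff)
qed

lemma exp_half_le_power:
  fixes x :: real assumes "0 \<le> x" "x \<le> 1" shows "exp (real N * x / 2) \<le> (1 + x) ^ N"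
proof -
  have "exp (x / 2) \<le> 1 + x / 2 + (x / 2)\<^sup>2" using assms by (intro exp_bound) auto
  also have "\<dots> \<le> 1 + x"
    using mult_left_le[of x x] assms by (simp add: power2_eq_square)
  finally have "exp (x / 2) ^ N \<le> (1 + x) ^ N" by (intro power_mono) auto
  then show ?thesis by (simp flip: exp_of_nat_mult)
qed

lemma eight_le_exp: "(8::real) \<le> exp (3 * x)" if "1 \<le> x" for x :: real
proof -
  have "(2::real) ^ 3 \<le> exp x ^ 3" using exp_ge_add_one_self[of x] that by (intro power_mono) linarith+
  then show ?thesis by (simp flip: exp_of_nat_mult)
qed

text \<open>Moving the sum of the noiseless point from $12\sqrt{nk}$ up to $24\sqrt{nk}$ multiplies the
  noisy tail by more than the inverse probability that a uniform point has sum at least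
  $24\sqrt{nk}$.\<close>

lemma noisy_tail_comparison:
  fixes n k :: nat and \<rho> t R :: real
  assumes k: "0 < k" and \<rho>: "0 < \<rho>" "\<rho> \<le> 1"
    and R: "R = sqrt (real n * real k)" and t: "t = 10 ^ 6 * R / \<rho>" and tn: "t \<le> real n / 8"
    and n: "0 < n"
  obtains m where
    "\<And>x. x \<in> cube n \<Longrightarrow> (\<Sum>i=1..n. x i) \<le> 12 * R \<Longrightarrow> signed_tail (\<rho> / 2) n x t \<le> m"
    "2 * m \<le> cube_avg n (\<lambda>x. signed_tail (\<rho> / 2) n x t)"
proof -
  define r where "r = \<rho> / 2"
  have r: "0 \<le> r" "r \<le> 1" using \<rho> by (simp_all add: r_def)
  have kn: "1 \<le> real k" "1 \<le> real n" using k n by simp_all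
  have R2: "R\<^sup>2 = real n * real k" by (simp add: R)
  have sqrtn: "1 \<le> sqrt (real n)" "sqrt (real n) \<le> R"
  proof -
    show "1 \<le> sqrt (real n)" using kn by simp
    show "sqrt (real n) \<le> R" unfolding R using kn mult_left_mono[of 1 "real k" "real n"] by simp
  qed
  then have R1: "1 \<le> R" by linarith
  have Rt: "1000000 * R \<le> t" unfolding t using R1 \<rho> by (simp add: pos_le_divide_eq mult_left_le)
  have rt: "r * t = 10 ^ 6 * R / 2" using \<rho> by (simp add: r_def t)
  \<comment> \<open>A sum 2 b - n of at most 12 R means b <= n/2 + 6 R, so \<open>a\<close> is the
    extreme case; \<open>a + N\<close> ones are available at every point of sum at least 24
    R.\<close>
  define a where "a = nat \<lfloor>real n / 2 + 6 * R\<rfloor>"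
  define N where "N = nat \<lfloor>6 * R\<rfloor>"
  have a: "real a \<le> real n / 2 + 6 * R" "real n / 2 + 6 * R - 1 \<le> real a"
    using R1 unfolding a_def by linarith+
  have N: "real N \<le> 6 * R" "6 * R - 1 \<le> real N" using R1 unfolding N_def by linarith+
  have aN: "a + N \<le> n"
  proof -
    have "real (a + N) \<le> real n" using a N Rt tn by simp
    then show ?thesis by simp
  qed
  define m where "m = tail r a (n - a) t"
  have m0: "0 \<le> m" unfolding m_def by (rule tail_nonneg[OF r])
  define \<Lambda> where "\<Lambda> = (1 + r * (t / (16 * real n))) ^ N"
  have growth: "\<Lambda> * m \<le> tail r (a + N) (n - (a + N)) t"
    unfolding \<Lambda>_def m_def
  proof (rule tail_growth[OF r _ _ n _ aN])
    have "8 * sqrt (real n) \<le> 8 * R" using sqrtn by simp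
    also have "\<dots> \<le> t" using Rt R1 by simp
    finally show "8 * sqrt (real n) \<le> t" .
    show "t \<le> real n" using tn kn by linarith
    show "real n \<le> 2 * real a" using a R1 by linarith
    have "2 * real (a + N) - real n \<le> 24 * R" using a N by simp
    then have "r * (2 * real (a + N) - real n) \<le> r * (24 * R)" using r by (intro mult_left_mono)
    also have "\<dots> \<le> 1 * (24 * R)" using r R1 by (intro mult_right_mono) auto
    finally have "r * (2 * real (a + N) - real n) \<le> 24 * R" by simp
    then show "r * (2 * real (a + N) - real n) \<le> t / 4" using Rt R1 by linarith
  qed
  \<comment> \<open>36864 = 64 * 24^2 is the exponent of the uniform tail bound at 24 R. Since N >=
    3 R, the growth supplies 3/2 * 31250 k = 46875 k, and the surplus covers the factor 8.\<close>
  have \<Lambda>_ge: "8 * exp (36864 * real k) \<le> \<Lambda>"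
  proof -
    define x where "x = r * (t / (16 * real n))"
    have x: "x = 31250 * R / real n" using rt kn by (simp add: x_def field_simps)
    have "31250 * R \<le> real n" using Rt tn R1 by linarith
    then have x01: "0 \<le> x" "x \<le> 1" using R1 kn by (simp_all add: x field_simps)
    have "x * R = 31250 * R\<^sup>2 / real n" by (simp add: x power2_eq_square)
    then have xR: "x * R = 31250 * real k" using n by (simp add: R2)
    have "8 * exp (36864 * real k) \<le> exp (3 * real k) * exp (36864 * real k)"
      using eight_le_exp[OF kn(1)] by (intro mult_right_mono) auto
    also have "\<dots> \<le> exp (46875 * real k)" by (simp flip: exp_add)
    also have "\<dots> = exp ((3 * R) * x / 2)" using xR by (simp add: mult_ac)
    also have "\<dots> \<le> exp (real N * x / 2)"
    proof -
      have "3 * R * x \<le> real N * x" using N R1 x01 by (intro mult_right_mono) linarith+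
      then show ?thesis by simp
    qed
    also have "\<dots> \<le> \<Lambda>" unfolding \<Lambda>_def x_def[symmetric] by (rule exp_half_le_power[OF x01])
    finally show ?thesis .
  qed
  show ?thesis
  proof (rule that[of m, folded r_def])
    fix x assume x: "x \<in> cube n" "(\<Sum>i=1..n. x i) \<le> 12 * R"
    obtain b where b: "b \<le> n" "(\<Sum>i=1..n. x i) = 2 * real b - real n"
      "signed_tail r n x = tail r b (n - b)" using signed_tail_cube[OF x(1)] .
    have "b \<le> a" unfolding a_def using x(2) b(2) by linarith
    then show "signed_tail r n x t \<le> m"
      unfolding b(3) m_def using aN by (intro tail_mono_plus[OF r]) auto
  next
    define I where "I x = (if 24 * R \<le> (\<Sum>i=1..n. x i) then 1 else 0 :: real)" for x :: "nat \<Rightarrow> real"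
    have "exp (- (36864 * real k)) / 4 = exp (- (64 * (24 * R)\<^sup>2 / real n)) / 4"
      using kn by (simp add: power_mult_distrib R2)
    also have "\<dots> \<le> cube_avg n I"
      unfolding I_def
    proof (rule cube_avg_tail_ge)
      show "24 * R \<le> real n / 8" using Rt tn R1 by linarith
      show "real n \<le> 8 * (24 * R)\<^sup>2"
        using mult_left_mono[OF kn(1), of "real n"] by (simp add: power_mult_distrib R2)
    qed (use R1 in simp)
    finally have I: "exp (- (36864 * real k)) / 4 \<le> cube_avg n I" .
    \<comment> \<open>Only points of sum at least 24 R are counted; each contributes at least
      \<Lambda> m.\<close>
    have "2 * m = 8 * exp (36864 * real k) * m * (exp (- (36864 * real k)) / 4)"
      by (simp add: exp_minus)
    also have "\<dots> \<le> \<Lambda> * m * cube_avg n I"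
      using \<Lambda>_ge I m0 by (intro mult_mono mult_nonneg_nonneg order_trans[OF _ \<Lambda>_ge]) auto
    also have "\<dots> = cube_avg n (\<lambda>x. \<Lambda> * m * I x)" by (simp add: cube_avg_cmult)
    also have "\<dots> \<le> cube_avg n (\<lambda>x. signed_tail r n x t)"
    proof (rule cube_avg_mono)
      fix x assume x: "x \<in> cube n"
      obtain b where b: "b \<le> n" "(\<Sum>i=1..n. x i) = 2 * real b - real n"
        "signed_tail r n x = tail r b (n - b)" using signed_tail_cube[OF x] .
      show "\<Lambda> * m * I x \<le> signed_tail r n x t"
      proof (cases "24 * R \<le> (\<Sum>i=1..n. x i)")
        case True
        then have "real (a + N) \<le> real b" using a N b(2) by simp
        then have "a + N \<le> b" by simp
        then have "tail r (a + N) (n - (a + N)) t \<le> tail r b (n - b) t"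
          using b(1) by (intro tail_mono_plus[OF r])
        with growth show ?thesis using True b(3) by (simp add: I_def)
      next
        case False
        then show ?thesis using tail_nonneg[OF r] b(3) by (simp add: I_def)
      qed
    qed
    finally show "2 * m \<le> cube_avg n (\<lambda>x. signed_tail r n x t)" .
  qed
qed

section \<open>Small bias after one round of noise\<close>

lemma power_le_two_powr_half:
  fixes n k :: nat
  assumes n: "0 < n" and k: "real k \<le> real n powr (1 / 3) / 10"
  shows "(real n) ^ k \<le> 2 powr (real n / 2)"
proof -
  \<comment> \<open>With n = y^3 <= exp (3 y) and k <= y/10, the power n^k is at most exp (3
    y^2/10), and y^2 <= n.\<close>
  define y where "y = real n powr (1 / 3)"
  have y: "1 \<le> y" using n by (simp add: y_def ge_one_powr_ge_zero)
  have y3: "y ^ 3 = real n" using n by (simp add: y_def powr_powr flip: powr_numeral)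
  have "real n \<le> exp (3 * y)"
  proof -
    have "y ^ 3 \<le> exp y ^ 3" using exp_ge_add_one_self[of y] y by (intro power_mono) linarith+
    then show ?thesis by (simp add: y3 flip: exp_of_nat_mult)
  qed
  then have "(real n) ^ k \<le> exp (3 * y) ^ k" by (intro power_mono) auto
  also have "\<dots> = exp (real k * (3 * y))" by (simp flip: exp_of_nat_mult)
  also have "\<dots> \<le> exp (ln 2 * (real n / 2))"
  proof -
    have "real k * (3 * y) \<le> y / 10 * (3 * y)" using k y by (intro mult_right_mono) (auto simp: y_def)
    also have "\<dots> = 3 / 10 * (y * y)" by simp
    also have "y * y \<le> y ^ 3" using y by (simp add: power3_eq_cube)
    also have "3 / 10 * y ^ 3 \<le> ln 2 * (real n / 2)"
    proof -
      have "2 / 3 * (real n / 2) \<le> ln 2 * (real n / 2)" using ln2_ge_two_thirds by (intro mult_right_mono) auto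
      then show ?thesis by (simp add: y3)
    qed
    finally show ?thesis by simp
  qed
  also have "\<dots> = 2 powr (real n / 2)" by (simp add: powr_def mult.commute)
  finally show ?thesis .
qed

text \<open>Three ranges of card S: below 2 k the coefficient vanishes, up to n/2 the binomial
  coefficient is large, and beyond n/2 the noise factor 2^(- card S) is small.\<close>

lemma biased_coord_product_noise:
  assumes k: "0 < k" "4 * k \<le> n" "real k \<le> real n powr (1 / 3) / 10"
    and D: "set_pmf D \<subseteq> cube n" "\<And>x. x \<in> cube n \<Longrightarrow> pmf D x = f x / 2 ^ n"
    and f0: "\<And>x. x \<in> cube n \<Longrightarrow> 0 \<le> f x" and f1: "cube_avg n f = 1"
    and low: "\<And>S. S \<subseteq> {1..n} \<Longrightarrow> S \<noteq> {} \<Longrightarrow> card S < 2 * k \<Longrightarrow> cube_avg n (\<lambda>x. f x * prod x S) = 0"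
    and high: "\<And>S. S \<subseteq> {1..n} \<Longrightarrow> (cube_avg n (\<lambda>x. f x * prod x S))\<^sup>2 * real (n choose card S) \<le> 4"
  shows "biased n ((4 * real k / real n) ^ k) (coord_product n D (noise n (1 / 2)))"
  unfolding biased_def
proof (intro allI impI, elim conjE)
  fix S assume S: "S \<subseteq> {1..n}" "S \<noteq> {}"
  define c where "c = cube_avg n (\<lambda>x. f x * prod x S)"
  have n: "0 < real n" "n > 0" using k by simp_all
  have "measure_pmf.expectation (coord_product n D (noise n (1 / 2))) (\<lambda>x. \<Prod>i\<in>S. x i)
    = (\<Sum>x\<in>cube n. pmf D x * (prod x S * (\<Sum>z\<in>cube n. noise_weight (1 / 2) n z * prod z S)))"
  proof -
    have "(\<Prod>i\<in>S. (\<lambda>i\<in>{1..n}. x i * z i) i) = prod x S * prod z S" for x z :: "nat \<Rightarrow> real"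
      using S(1) unfolding prod.distrib[symmetric] by (intro prod.cong) auto
    then show ?thesis
      unfolding expectation_coord_product[OF D(1), of "1 / 2", simplified] sum_distrib_left
      by (simp add: mult_ac)
  qed
  also have "\<dots> = c * (1 / 2) ^ card S"
    unfolding sum_noise_weight_prod[OF S(1)] c_def cube_avg_def sum_divide_distrib sum_distrib_right
    by (intro sum.cong refl) (simp add: D(2))
  finally have E: "measure_pmf.expectation (coord_product n D (noise n (1 / 2))) (\<lambda>x. \<Prod>i\<in>S. x i)
    = c * (1 / 2) ^ card S" .
  have "\<bar>c\<bar> * (1 / 2) ^ card S \<le> (4 * real k / real n) ^ k"
  proof -
    consider "card S < 2 * k" | "2 * k \<le> card S" "2 * card S \<le> n" | "n < 2 * card S" by linarith
    then show ?thesis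
    proof cases
      case 1
      then show ?thesis using low[OF S 1] by (simp add: c_def)
    next
      case 2
      \<comment> \<open>w^(2 k) is a lower bound for n choose 2 k. The bound |c| w^k <= 2 becomes
        (2/w)^k because k >= 1.\<close>
      define w where "w = real n / (2 * real k)"
      have w: "0 < w" using n k by (simp add: w_def)
      have "w ^ (2 * k) \<le> real (n choose (2 * k))"
        using binomial_ge_n_over_k_pow_k[of "2 * k" n, where ?'a = real] k by (simp add: w_def)
      also have "\<dots> \<le> real (n choose card S)" using binomial_mono[OF 2] by simp
      finally have "c\<^sup>2 * w ^ (2 * k) \<le> c\<^sup>2 * real (n choose card S)" by (rule mult_left_mono) simp
      also have "\<dots> \<le> 4" using high[OF S(1)] by (simp add: c_def)
      finally have "(\<bar>c\<bar> * w ^ k)\<^sup>2 \<le> 2\<^sup>2" by (simp add: power_mult_distrib power_mult mult.commute[of 2 k])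
      then have "\<bar>c\<bar> * w ^ k \<le> 2" by (rule power2_le_imp_le) simp
      also have "(2::real) \<le> 2 ^ k" using k self_le_power[of "2::real" k] by simp
      finally have "\<bar>c\<bar> \<le> (2 / w) ^ k" using w by (simp add: power_divide field_simps)
      moreover have "2 / w = 4 * real k / real n" using n k by (simp add: w_def field_simps)
      moreover have "\<bar>c\<bar> * (1 / 2) ^ card S \<le> \<bar>c\<bar>" by (intro mult_left_le) (auto simp: power_le_one)
      ultimately show ?thesis by simp
    next
      case 3
      have "\<bar>c\<bar> \<le> 1"
      proof -
        have abs1: "\<bar>prod x S\<bar> = 1" if "x \<in> cube n" for x
          unfolding abs_prod using S(1) cubeD[OF that] by (intro prod.neutral) fastforce
        have "\<bar>c\<bar> \<le> cube_avg n f"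
          unfolding c_def cube_avg_def abs_divide
          by (intro divide_mono order_trans[OF sum_abs] sum_mono) (auto simp: abs_mult abs1 f0)
        then show ?thesis by (simp add: f1)
      qed
      then have "\<bar>c\<bar> * (1 / 2) ^ card S \<le> 1 * (1 / 2) ^ card S" by (intro mult_right_mono) auto
      also have "\<dots> = 1 / 2 powr real (card S)" by (simp add: power_one_over powr_realpow)
      also have "\<dots> \<le> 1 / 2 powr (real n / 2)" using 3 by (intro divide_left_mono powr_mono) auto
      also have "\<dots> \<le> 1 / real n ^ k"
        using power_le_two_powr_half[OF n(2) k(3)] n by (intro divide_left_mono) auto
      also have "\<dots> \<le> (4 * real k / real n) ^ k"
      proof -
        have "1 / real n \<le> 4 * real k / real n" using k n by (intro divide_right_mono) auto
        then have "(1 / real n) ^ k \<le> (4 * real k / real n) ^ k" by (intro power_mono) auto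
        then show ?thesis by (simp add: power_one_over)
      qed
      finally show ?thesis .
    qed
  qed
  then show "\<bar>measure_pmf.expectation (coord_product n D (noise n (1 / 2))) (\<lambda>x. \<Prod>i\<in>S. x i)\<bar>
    \<le> (4 * real k / real n) ^ k"
    unfolding E by (simp add: abs_mult)
qed

section \<open>Choice of the constants and assembly\<close>

theorem mainTheorem7:
  shows "\<exists>c1 c2 c3 c4 :: real. c1 > 0 \<and> c2 > 0 \<and> c3 > 0 \<and> c4 > 0 \<and>
    (\<forall>(n::nat) (\<rho>::real) (k::nat).
       0 < \<rho> \<and> \<rho> \<le> 1 \<and> 0 < k \<and> real k \<le> c1 * \<rho>^2 * real n powr (1/3) \<longrightarrow>
       (\<exists>(D :: (nat \<Rightarrow> real) pmf) (t::real).
          distribution_on_cube n D \<and>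
          biased n ((c2 * real k / real n) ^ k) D \<and>
          t = c3 * sqrt (real n * real k) / \<rho> \<and>
          measure_pmf.prob (uniform_cube n) {u. coord_sum n u \<ge> t}
            \<ge> measure_pmf.prob (coord_product n D (noise n \<rho>)) {x. coord_sum n x \<ge> t}
               + 2 powr (- (c4 * real k / \<rho>^2))))"
proof -
  \<comment> \<open>\<open>c3\<close> is the constant of \<open>noisy_tail_comparison\<close>.
    \<open>c1\<close> makes t^2 <= c3^2 c1 n^2 = (n/8)^2. Half of \<open>c4\<close> is 64 c3^2 + 3:
    the exponent of the uniform tail at t, and 3 for a factor 8.\<close>
  define c3 :: real where "c3 = 10 ^ 6"
  define c1 where "c1 = 1 / (64 * c3\<^sup>2)"
  define c4 where "c4 = 128 * c3\<^sup>2 + 6"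
  have main: "\<exists>(D :: (nat \<Rightarrow> real) pmf) (t::real).
      distribution_on_cube n D \<and>
      biased n ((4 * real k / real n) ^ k) D \<and>
      t = c3 * sqrt (real n * real k) / \<rho> \<and>
      measure_pmf.prob (uniform_cube n) {u. coord_sum n u \<ge> t}
        \<ge> measure_pmf.prob (coord_product n D (noise n \<rho>)) {x. coord_sum n x \<ge> t}
           + 2 powr (- (c4 * real k / \<rho>^2))"
    if \<rho>: "0 < \<rho>" "\<rho> \<le> 1" and k: "0 < k" and kn: "real k \<le> c1 * \<rho>^2 * real n powr (1/3)"
    for n k :: nat and \<rho> :: real
  proof -
    define R where "R = sqrt (real n * real k)"
    define t where "t = c3 * R / \<rho>"
    define K where "K = real k / \<rho>\<^sup>2"
    have n: "0 < n" using kn k by (intro Nat.gr0I) auto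
    then have n1: "1 \<le> real n" by simp
    have \<rho>2: "0 < \<rho>\<^sup>2" "\<rho>\<^sup>2 \<le> 1" using \<rho> by (simp_all add: power_le_one)
    have c1: "0 < c1" "c1 \<le> 1 / 10" by (simp_all add: c1_def c3_def)
    have K_le: "K \<le> c1 * real n powr (1/3)" using kn \<rho>2 by (simp add: K_def pos_divide_le_eq mult_ac)
    have kK: "real k \<le> K" using \<rho>2 k by (simp add: K_def pos_le_divide_eq mult_left_le)
    have K1: "1 \<le> K" using kK k by linarith
    have cube_root: "real n powr (1/3) \<le> real n" using powr_mono[of "1/3" 1 "real n"] n1 by simp
    have Kn: "K \<le> c1 * real n"
      using K_le mult_left_mono[OF cube_root, of c1] c1 by linarith
    have k_root: "real k \<le> real n powr (1 / 3) / 10"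
      using kK K_le mult_right_mono[OF c1(2), of "real n powr (1/3)"] by simp
    have k4: "4 * k \<le> n"
    proof -
      have "4 * real k \<le> real n"
        using kK Kn n1 by (simp add: c1_def c3_def)
      then show ?thesis by linarith
    qed
    have R0: "0 < R" using n k by (simp add: R_def)
    have t0: "0 < t" using R0 \<rho> by (simp add: t_def c3_def)
    have t2: "t\<^sup>2 = c3\<^sup>2 * (real n * K)"
      by (simp add: t_def K_def R_def power_mult_distrib power_divide)
    have tn: "t \<le> real n / 8"
    proof (rule power2_le_imp_le)
      have "c3\<^sup>2 * (real n * K) \<le> c3\<^sup>2 * (real n * (c1 * real n))"
        using Kn by (intro mult_left_mono) auto
      then show "t\<^sup>2 \<le> (real n / 8)\<^sup>2"
        unfolding t2 by (simp add: c1_def c3_def power2_eq_square)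
    qed simp
    obtain m where m: "\<And>x. x \<in> cube n \<Longrightarrow> (\<Sum>i=1..n. x i) \<le> 12 * R \<Longrightarrow> signed_tail (\<rho> / 2) n x t \<le> m"
      "2 * m \<le> cube_avg n (\<lambda>x. signed_tail (\<rho> / 2) n x t)"
      using noisy_tail_comparison[OF k \<rho> R_def t_def[unfolded c3_def] tn n] by blast
    obtain f where f: "\<And>x. x \<in> cube n \<Longrightarrow> 0 \<le> f x"
      "\<And>x. x \<in> cube n \<Longrightarrow> 12 * sqrt (real n * real k) < \<bar>\<Sum>i=1..n. x i\<bar> \<Longrightarrow> f x = 0"
      "cube_avg n f = 1"
      "\<And>S. S \<subseteq> {1..n} \<Longrightarrow> S \<noteq> {} \<Longrightarrow> card S < 2 * k \<Longrightarrow> cube_avg n (\<lambda>x. f x * prod x S) = 0"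
      "\<And>S. S \<subseteq> {1..n} \<Longrightarrow> (cube_avg n (\<lambda>x. f x * prod x S))\<^sup>2 * real (n choose card S) \<le> 4"
      using bounded_support_density[OF k k4] by blast
    obtain D0 where D0: "set_pmf D0 \<subseteq> cube n" "\<And>x. x \<in> cube n \<Longrightarrow> pmf D0 x = f x / 2 ^ n"
      using pmf_with_density[OF f(1,3)] by blast
    \<comment> \<open>The extra round of noise, which damps the levels above n/2.\<close>
    define D where "D = coord_product n D0 (noise n (1 / 2))"
    have D: "set_pmf D \<subseteq> cube n" unfolding D_def by (rule coord_product_support[OF D0(1)]) simp_all
    define U where "U = measure_pmf.prob (uniform_cube n) {u. coord_sum n u \<ge> t}"
    define V where "V = measure_pmf.prob (coord_product n D (noise n \<rho>)) {x. coord_sum n x \<ge> t}"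
    \<comment> \<open>Free choice of \<open>r\<close>: r = 1 serves the lower bound on
      \<open>U\<close>, r = \<rho>/2 the comparison with \<open>V\<close>.\<close>
    have U: "U = cube_avg n (\<lambda>x. signed_tail r n x t)" for r
      unfolding U_def by (rule prob_uniform_cube_coord_sum_ge)
    have "V = measure_pmf.expectation D0 (\<lambda>x. signed_tail (\<rho> / 2) n x t)"
    proof -
      have "V = measure_pmf.expectation D (\<lambda>x. signed_tail \<rho> n x t)"
        unfolding V_def using \<rho> coord_product_support[OF D, of \<rho>]
        by (simp add: prob_coord_sum_ge expectation_signed_tail_coord_product[OF D])
      then show ?thesis
        unfolding D_def by (simp add: expectation_signed_tail_coord_product[OF D0(1)])
    qed
    also have "\<dots> = (\<Sum>x\<in>cube n. signed_tail (\<rho> / 2) n x t * pmf D0 x)"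
      using D0(1) by (intro integral_measure_pmf_real) auto
    \<comment> \<open>\<open>D0\<close> gives no mass to sums above 12 R, and \<open>m\<close>
      bounds the noisy tail at all others.\<close>
    also have "\<dots> \<le> (\<Sum>x\<in>cube n. m * pmf D0 x)"
    proof (intro sum_mono)
      fix x assume x: "x \<in> cube n"
      show "signed_tail (\<rho> / 2) n x t * pmf D0 x \<le> m * pmf D0 x"
      proof (cases "(\<Sum>i=1..n. x i) \<le> 12 * R")
        case True
        then show ?thesis using m(1)[OF x] by (intro mult_right_mono) auto
      next
        case False
        then have "f x = 0" using f(2)[OF x] by (simp add: R_def)
        then show ?thesis using D0(2)[OF x] by simp
      qed
    qed
    also have "\<dots> = m"
    proof -
      have "(\<Sum>x\<in>cube n. pmf D0 x) = cube_avg n f"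
        unfolding cube_avg_def sum_divide_distrib by (intro sum.cong refl D0(2))
      then show ?thesis by (simp add: f(3) flip: sum_distrib_left)
    qed
    finally have V: "V \<le> m" .
    \<comment> \<open>As V <= m <= U/2, the separation is at least U/2.\<close>
    have "2 powr (- (c4 * real k / \<rho>\<^sup>2)) \<le> U / 2"
    proof -
      have "exp (- (64 * t\<^sup>2 / real n)) / 4 \<le> U"
      proof -
        have "U = cube_avg n (\<lambda>x. if t \<le> (\<Sum>i=1..n. x i) then 1 else 0)"
          unfolding U[of 1] by (intro cube_avg_cong signed_tail_one cubeD)
        moreover have "real n \<le> 8 * t\<^sup>2"
          unfolding t2 using mult_left_mono[OF K1, of "real n"] by (simp add: c3_def)
        ultimately show ?thesis using cube_avg_tail_ge[OF t0 tn] by simp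
      qed
      moreover have "64 * t\<^sup>2 / real n = 64 * c3\<^sup>2 * K" unfolding t2 using n1 by simp
      ultimately have U_ge: "exp (- (64 * c3\<^sup>2 * K)) / 4 \<le> U" by simp
      have "2 powr (- (c4 * real k / \<rho>\<^sup>2)) = exp (- (ln 2 * (c4 * K)))"
        by (simp add: powr_def K_def mult.commute)
      \<comment> \<open>Base 2 is traded for base e through ln 2 >= 1/2, which the factor 2 in
        \<open>c4\<close> pays for.\<close>
      also have "\<dots> \<le> exp (- (1 / 2 * (c4 * K)))"
      proof -
        have "1 / 2 * (c4 * K) \<le> ln 2 * (c4 * K)"
          using ln2_ge_two_thirds K1 by (intro mult_right_mono) (auto simp: c4_def)
        then show ?thesis by simp
      qed
      also have "\<dots> = exp (- (64 * c3\<^sup>2 * K)) / exp (3 * K)"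
        by (simp add: c4_def algebra_simps flip: exp_diff)
      also have "\<dots> \<le> exp (- (64 * c3\<^sup>2 * K)) / 8"
        using eight_le_exp[OF K1] by (intro divide_left_mono) auto
      also have "\<dots> \<le> U / 2" using U_ge by simp
      finally show ?thesis .
    qed
    then have "V + 2 powr (- (c4 * real k / \<rho>\<^sup>2)) \<le> U" using V m(2) U[of "\<rho> / 2"] by linarith
    moreover have "biased n ((4 * real k / real n) ^ k) D"
      unfolding D_def by (rule biased_coord_product_noise[OF k k4 k_root D0 f(1,3,4,5)])
    ultimately show ?thesis
      using D unfolding U_def V_def
      by (intro exI[of _ D] exI[of _ t]) (simp add: distribution_on_cube_def t_def R_def)
  qed
  have "0 < c1" "0 < c3" "0 < c4" by (simp_all add: c1_def c3_def c4_def)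
  with main show ?thesis
    by (intro exI[of _ c1] exI[of _ "4::real"] exI[of _ c3] exI[of _ c4]) auto
qed

end
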